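(* Let $(M^n,g)$ be a Riemannian manifold and let $E$ be a distribution of rank $r$ on $M$, with orthogonal complement $E^\perp\subset TM$ with respect to $g$. Then there is a unique affine connection $\nabla$ on $M$ that is compatible with $g$ and whose torsion tensor $\tau$ satisfies the following properties for all $X,Y\in\Gamma(E)$ and all $\xi,\eta\in\Gamma(E^\perp)$: (1) $\tau(X,Y)=0$ and $\tau(\xi,\eta)=0$; (2) $g(\tau(\xi,X),Y)=\frac12 (L_\xi g)(X,Y)$; (3) $g(\tau(\xi,X),\eta)=-\frac12 (L_X g)(\xi,\eta)$.
   Context: A distribution of rank $r$ on a smooth manifold $M^n$ is a smooth vector subbundle $E$ of $TM$ of rank $r$. $\Gamma(\cdot)$ denotes the space of smooth sections, and $L$ denotes the Lie derivative. An affine connection $\nabla$ on $M$ is a connection on $TM$; it is compatible with $g$ if $\nabla g=0$. Its torsion tensor is $\tau(X,Y)=\nabla_XY-\nabla_YX-[X,Y]$ for $X,Y\in\Gamma(TM)$, a smooth section of $\mathrm{Hom}(\wedge^2TM,TM)$. *)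

theory Defs
  imports "HOL-Analysis.Analysis" "HOL-Library.Function_Algebras" "HOL-Library.FuncSet"
begin

section \<open>Real-valued functionals as a real vector space\<close>

text \<open>With the pointwise scalar multiplication, the library notions of subspace, span and linear
  independence apply to tangent vectors, which are represented below as derivations.\<close>

instantiation "fun" :: (type, real_vector) real_vector
begin

definition "scaleR_fun c f = (\<lambda>x. c *\<^sub>R f x)"

instance
  by standard (auto simp: scaleR_fun_def fun_eq_iff scaleR_add_right scaleR_add_left)

end

section \<open>Smooth maps between open subsets of Euclidean spaces\<close>

text \<open>Both notions are meant for open \<^term>\<open>S\<close>.\<close>

primrec Ck_on :: "nat \<Rightarrow> ('e::euclidean_space \<Rightarrow> 'b::real_normed_vector) \<Rightarrow> 'e set \<Rightarrow> bool" where
  "Ck_on 0 f S \<longleftrightarrow> continuous_on S f"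
| "Ck_on (Suc k) f S \<longleftrightarrow>
     (\<forall>x\<in>S. f differentiable (at x)) \<and> (\<forall>v. Ck_on k (\<lambda>x. frechet_derivative f (at x) v) S)"

definition smooth_on :: "('e::euclidean_space \<Rightarrow> 'b::real_normed_vector) \<Rightarrow> 'e set \<Rightarrow> bool" where
  "smooth_on f S \<longleftrightarrow> (\<forall>k. Ck_on k f S)"

section \<open>Smooth manifolds\<close>

text \<open>A chart is a pair of an open domain and a coordinate map; only the values of the coordinate
  map on the domain matter. The manifold is the whole topological space \<^typ>\<open>'a\<close>, of dimension
  \<open>DIM('e)\<close>; Hausdorffness and second countability are imposed on \<^typ>\<open>'a\<close> through its
  type class. The atlas need not be maximal: the notions below depend only on the smooth
  structure it generates.\<close>

type_synonym ('a, 'e) chart = "'a set \<times> ('a \<Rightarrow> 'e)"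

definition is_chart :: "('a::topological_space, 'e::euclidean_space) chart \<Rightarrow> bool" where
  "is_chart c \<longleftrightarrow> (case c of (U, \<phi>) \<Rightarrow>
     open U \<and> open (\<phi> ` U) \<and> homeomorphism U (\<phi> ` U) \<phi> (inv_into U \<phi>))"

definition smooth_atlas :: "('a::topological_space, 'e::euclidean_space) chart set \<Rightarrow> bool" where
  "smooth_atlas A \<longleftrightarrow>
     (\<forall>c\<in>A. is_chart c) \<and>
     (\<Union>(U, \<phi>)\<in>A. U) = UNIV \<and>
     (\<forall>(U, \<phi>)\<in>A. \<forall>(V, \<psi>)\<in>A. smooth_on (\<psi> \<circ> inv_into U \<phi>) (\<phi> ` (U \<inter> V)))"

text \<open>Smoothness of a real function on an open subset \<^term>\<open>W\<close> of the manifold.\<close>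

definition smooth_fun_on ::
  "('a::topological_space, 'e::euclidean_space) chart set \<Rightarrow> 'a set \<Rightarrow> ('a \<Rightarrow> real) \<Rightarrow> bool" where
  "smooth_fun_on A W f \<longleftrightarrow> (\<forall>(U, \<phi>)\<in>A. smooth_on (f \<circ> inv_into U \<phi>) (\<phi> ` (U \<inter> W)))"

definition C_inf :: "('a::topological_space, 'e::euclidean_space) chart set \<Rightarrow> ('a \<Rightarrow> real) set" where
  "C_inf A = {f. smooth_fun_on A UNIV f}"

section \<open>Tangent vectors and vector fields\<close>

text \<open>Tangent vectors at \<open>p\<close> are derivations at \<open>p\<close> of the algebra of smooth functions. As HOL
  functions are total, a derivation is given the value 0 on functions that are not smooth, so that
  equality of tangent vectors is equality of functionals and the tangent space is a linear
  subspace of all functionals.\<close>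

type_synonym 'a tvec = "('a \<Rightarrow> real) \<Rightarrow> real"
type_synonym 'a vfield = "'a \<Rightarrow> 'a tvec"

definition tangent_space ::
  "('a::topological_space, 'e::euclidean_space) chart set \<Rightarrow> 'a \<Rightarrow> 'a tvec set" where
  "tangent_space A p = {v.
     (\<forall>f\<in>C_inf A. \<forall>h\<in>C_inf A. \<forall>a b. v (\<lambda>q. a * f q + b * h q) = a * v f + b * v h) \<and>
     (\<forall>f\<in>C_inf A. \<forall>h\<in>C_inf A. v (\<lambda>q. f q * h q) = f p * v h + h p * v f) \<and>
     (\<forall>f. f \<notin> C_inf A \<longrightarrow> v f = 0)}"

definition smooth_vfield_on ::
  "('a::topological_space, 'e::euclidean_space) chart set \<Rightarrow> 'a set \<Rightarrow> 'a vfield \<Rightarrow> bool" where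
  "smooth_vfield_on A W X \<longleftrightarrow>
     (\<forall>p\<in>W. X p \<in> tangent_space A p) \<and> (\<forall>f\<in>C_inf A. smooth_fun_on A W (\<lambda>p. X p f))"

definition vfields :: "('a::topological_space, 'e::euclidean_space) chart set \<Rightarrow> 'a vfield set" where
  "vfields A = {X. smooth_vfield_on A UNIV X}"

definition lie_bracket :: "'a vfield \<Rightarrow> 'a vfield \<Rightarrow> 'a vfield" where
  "lie_bracket X Y = (\<lambda>p f. X p (\<lambda>q. Y q f) - Y p (\<lambda>q. X q f))"

section \<open>Riemannian metrics and Lie derivatives of covariant 2-tensors\<close>

type_synonym 'a tensor2 = "'a \<Rightarrow> 'a tvec \<Rightarrow> 'a tvec \<Rightarrow> real"

definition riemannian_metric ::
  "('a::topological_space, 'e::euclidean_space) chart set \<Rightarrow> 'a tensor2 \<Rightarrow> bool" where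
  "riemannian_metric A g \<longleftrightarrow>
     (\<forall>p. \<forall>u\<in>tangent_space A p. \<forall>v\<in>tangent_space A p. \<forall>w\<in>tangent_space A p. \<forall>a b.
        g p (a *\<^sub>R u + b *\<^sub>R v) w = a * g p u w + b * g p v w) \<and>
     (\<forall>p. \<forall>u\<in>tangent_space A p. \<forall>v\<in>tangent_space A p. g p u v = g p v u) \<and>
     (\<forall>p. \<forall>u\<in>tangent_space A p. u \<noteq> 0 \<longrightarrow> g p u u > 0) \<and>
     (\<forall>X\<in>vfields A. \<forall>Y\<in>vfields A. (\<lambda>p. g p (X p) (Y p)) \<in> C_inf A)"

text \<open>The Lie derivative along \<open>X\<close>, extended from functions and vector fields to covariant
  2-tensors by the product rule for \<open>X (h(Y, Z))\<close>.\<close>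

definition lie_derivative ::
  "'a vfield \<Rightarrow> 'a tensor2 \<Rightarrow> 'a vfield \<Rightarrow> 'a vfield \<Rightarrow> 'a \<Rightarrow> real" where
  "lie_derivative X h Y Z p =
     X p (\<lambda>q. h q (Y q) (Z q)) - h p (lie_bracket X Y p) (Z p) - h p (Y p) (lie_bracket X Z p)"

section \<open>Distributions\<close>

text \<open>A smooth subbundle of rank \<^term>\<open>r\<close> of the tangent bundle: near every point there is a
  smooth local frame of \<^term>\<open>r\<close> vector fields.\<close>

definition distribution ::
  "('a::topological_space, 'e::euclidean_space) chart set \<Rightarrow> nat \<Rightarrow> ('a \<Rightarrow> 'a tvec set) \<Rightarrow> bool" where
  "distribution A r E \<longleftrightarrow>
     (\<forall>p. \<exists>W F. open W \<and> p \<in> W \<and>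
        (\<forall>i<r. smooth_vfield_on A W (F i)) \<and>
        (\<forall>q\<in>W. inj_on (\<lambda>i. F i q) {..<r} \<and>
               independent ((\<lambda>i. F i q) ` {..<r}) \<and>
               span ((\<lambda>i. F i q) ` {..<r}) = E q))"

definition orth_complement ::
  "('a::topological_space, 'e::euclidean_space) chart set \<Rightarrow> 'a tensor2 \<Rightarrow>
   ('a \<Rightarrow> 'a tvec set) \<Rightarrow> 'a \<Rightarrow> 'a tvec set" where
  "orth_complement A g E p = {v \<in> tangent_space A p. \<forall>w\<in>E p. g p v w = 0}"

definition sections ::
  "('a::topological_space, 'e::euclidean_space) chart set \<Rightarrow> ('a \<Rightarrow> 'a tvec set) \<Rightarrow> 'a vfield set" where
  "sections A E = {X \<in> vfields A. \<forall>p. X p \<in> E p}"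

section \<open>Affine connections\<close>

text \<open>\<open>D X Y\<close> is the covariant derivative of \<open>Y\<close> along \<open>X\<close>. The extensional function space
  makes equality of connections the same as agreement on smooth vector fields.\<close>

definition affine_connection ::
  "('a::topological_space, 'e::euclidean_space) chart set \<Rightarrow>
   ('a vfield \<Rightarrow> 'a vfield \<Rightarrow> 'a vfield) \<Rightarrow> bool" where
  "affine_connection A D \<longleftrightarrow>
     D \<in> vfields A \<rightarrow>\<^sub>E (vfields A \<rightarrow>\<^sub>E vfields A) \<and>
     (\<forall>X\<in>vfields A. \<forall>Y\<in>vfields A. \<forall>Z\<in>vfields A. D (X + Y) Z = D X Z + D Y Z) \<and>
     (\<forall>X\<in>vfields A. \<forall>Y\<in>vfields A. \<forall>f\<in>C_inf A.
        D (\<lambda>p. f p *\<^sub>R X p) Y = (\<lambda>p. f p *\<^sub>R D X Y p)) \<and>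
     (\<forall>X\<in>vfields A. \<forall>Y\<in>vfields A. \<forall>Z\<in>vfields A. D X (Y + Z) = D X Y + D X Z) \<and>
     (\<forall>X\<in>vfields A. \<forall>Y\<in>vfields A. \<forall>f\<in>C_inf A.
        D X (\<lambda>p. f p *\<^sub>R Y p) = (\<lambda>p. X p f *\<^sub>R Y p + f p *\<^sub>R D X Y p))"

definition cov_derivative ::
  "('a vfield \<Rightarrow> 'a vfield \<Rightarrow> 'a vfield) \<Rightarrow> 'a vfield \<Rightarrow> 'a tensor2 \<Rightarrow>
   'a vfield \<Rightarrow> 'a vfield \<Rightarrow> 'a \<Rightarrow> real" where
  "cov_derivative D X h Y Z p =
     X p (\<lambda>q. h q (Y q) (Z q)) - h p (D X Y p) (Z p) - h p (Y p) (D X Z p)"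

definition metric_compatible ::
  "('a::topological_space, 'e::euclidean_space) chart set \<Rightarrow> 'a tensor2 \<Rightarrow>
   ('a vfield \<Rightarrow> 'a vfield \<Rightarrow> 'a vfield) \<Rightarrow> bool" where
  "metric_compatible A g D \<longleftrightarrow>
     (\<forall>X\<in>vfields A. \<forall>Y\<in>vfields A. \<forall>Z\<in>vfields A. \<forall>p. cov_derivative D X g Y Z p = 0)"

definition torsion ::
  "('a vfield \<Rightarrow> 'a vfield \<Rightarrow> 'a vfield) \<Rightarrow> 'a vfield \<Rightarrow> 'a vfield \<Rightarrow> 'a vfield" where
  "torsion D X Y = D X Y - D Y X - lie_bracket X Y"

end

theory Submission
  imports Defs
begin

text \<open>
  A metric connection is determined by its torsion, and the torsion can be prescribed freely: if
  \<open>t(X, Y, Z)\<close> is linear over the smooth functions in each argument and skew in \<open>X, Y\<close>, then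
  \<open>\<nabla>g = 0\<close> and \<open>g(\<tau>(X, Y), Z) = t(X, Y, Z)\<close> together are equivalent to the Koszul formula in
  which \<open>g([X, Y], Z)\<close> is replaced by \<open>g([X, Y], Z) + t(X, Y, Z)\<close>. The right-hand side of that
  formula is linear over functions in \<open>X\<close> and \<open>Z\<close> and a derivation in \<open>Y\<close>, hence defines exactly
  one connection (\<open>metric_connection_with_torsion\<close>).

  It remains to see that conditions (1)-(3) prescribe the torsion in this sense
  (\<open>torsion_conditions_iff\<close>). Each vector field splits as \<open>X = hor X + ver X\<close> along \<open>E\<close> and its
  orthogonal complement. By additivity, skewness and (1), \<open>\<tau>(X, Y)\<close> is
  \<open>\<tau>(ver X, hor Y) - \<tau>(ver Y, hor X)\<close>, and (2) and (3) give the products of \<open>\<tau>(\<xi>, X)\<close> with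
  the sections of \<open>E\<close> and of its complement. The point is that the prescribed values are tensorial. Now
  \<open>(L\<^bsub>f\<xi>\<^esub> g)(X, Y) = f (L\<^bsub>\<xi>\<^esub> g)(X, Y) + (X f) g(\<xi>, Y) + (Y f) g(\<xi>, X)\<close>, and the last two terms
  vanish because \<open>\<xi>\<close> is orthogonal to \<open>X\<close> and \<open>Y\<close>; so the Lie derivative of the metric, which is not
  a tensor in its direction, becomes one on these arguments (\<open>torsion_form_tensorial\<close>).

  What turns such formulas into vector fields is \<open>riesz_representation\<close>: a functional on the
  sections of a distribution that is linear over functions is the inner product with a unique section.
  For \<open>E\<close> it yields the orthogonal projection, for the tangent bundle the covariant
  derivative. Its proof expands sections in a local orthogonal frame. That the tangent bundle has local
  frames at all needs work here, because tangent vectors are abstract derivations: Hadamard's lemma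
  shows that every derivation is a combination of coordinate derivatives (\<open>coord_field_span\<close>).
  Derivations see only global functions, so local objects are multiplied throughout by a
  smooth bump function that is nonzero near the point considered.
\<close>

section \<open>Calculus of smooth maps between Euclidean spaces\<close>

lemma Ck_on_has_derivative:
  "Ck_on (Suc k) f S \<Longrightarrow> x \<in> S \<Longrightarrow> (f has_derivative frechet_derivative f (at x)) (at x)"
  by (simp add: frechet_derivative_works[symmetric])

lemma Ck_on_cong:
  assumes "open S" "\<And>x. x \<in> S \<Longrightarrow> f x = g x" "Ck_on k f S"
  shows "Ck_on k g S"
  using assms(2,3)
proof (induction k arbitrary: f g)
  case 0
  then show ?case using continuous_on_cong[of S S f g] by simp
next
  case (Suc k)
  have "(g has_derivative frechet_derivative f (at x)) (at x)" if "x \<in> S" for x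
    using Ck_on_has_derivative[OF Suc.prems(2) that] assms(1) that Suc.prems(1)
    by (rule has_derivative_transform_within_open)
  then have D: "\<forall>x\<in>S. g differentiable (at x)" "\<And>x. x \<in> S \<Longrightarrow> frechet_derivative f (at x) = frechet_derivative g (at x)"
    using frechet_derivative_at by (auto simp: differentiable_def)
  have "Ck_on k (\<lambda>x. frechet_derivative g (at x) v) S" for v
    by (rule Suc.IH[of "\<lambda>x. frechet_derivative f (at x) v"]) (use D(2) Suc.prems(2) in auto)
  then show ?case using D(1) by simp
qed

text \<open>Any formula for the derivative may be used to establish smoothness, since it agrees with
  \<^const>\<open>frechet_derivative\<close> on the open set \<open>S\<close>.\<close>

lemma Ck_onI:
  assumes "open S" "\<And>x. x \<in> S \<Longrightarrow> (f has_derivative f' x) (at x)" "\<And>v. Ck_on k (\<lambda>x. f' x v) S"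
  shows "Ck_on (Suc k) f S"
proof -
  have "f' x = frechet_derivative f (at x)" if "x \<in> S" for x
    using assms(2)[OF that] by (simp add: frechet_derivative_at[symmetric])
  then have "Ck_on k (\<lambda>x. frechet_derivative f (at x) v) S" for v
    by (intro Ck_on_cong[OF assms(1) _ assms(3)[of v]]) simp
  then show ?thesis using assms(2) by (auto simp: differentiable_def)
qed

lemma Ck_on_subset: "Ck_on k f S \<Longrightarrow> T \<subseteq> S \<Longrightarrow> Ck_on k f T"
  by (induction k arbitrary: f) (auto intro: continuous_on_subset)

lemma Ck_on_Suc_imp: "Ck_on (Suc k) f S \<Longrightarrow> Ck_on k f S"
proof (induction k arbitrary: f)
  case 0
  then show ?case
    by (auto intro!: continuous_at_imp_continuous_on differentiable_imp_continuous_within)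
next
  case (Suc k)
  then show ?case by (metis Ck_on.simps(2))
qed

lemma Ck_on_locally:
  assumes "\<And>x. x \<in> S \<Longrightarrow> \<exists>T. open T \<and> x \<in> T \<and> Ck_on k f T"
  shows "Ck_on k f S"
  using assms
proof (induction k arbitrary: f)
  case 0
  then show ?case
    by (metis Ck_on.simps(1) continuous_at_imp_continuous_on continuous_on_eq_continuous_at)
next
  case (Suc k)
  then show ?case by (metis Ck_on.simps(2))
qed

lemma Ck_on_const [simp]: "Ck_on k (\<lambda>x. c) S"
  by (induction k arbitrary: c) auto

lemma Ck_on_add:
  assumes "open S" "Ck_on k f S" "Ck_on k g S"
  shows "Ck_on k (\<lambda>x. f x + g x) S"
  using assms(2,3)
proof (induction k arbitrary: f g)
  case 0
  then show ?case by (simp add: continuous_on_add)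
next
  case (Suc k)
  show ?case
    using Suc.IH Suc.prems
    by (intro Ck_onI[OF assms(1) has_derivative_add[OF Ck_on_has_derivative Ck_on_has_derivative]])
       auto
qed

lemma Ck_on_linear_image:
  assumes "bounded_linear L" "open S" "Ck_on k f S"
  shows "Ck_on k (\<lambda>x. L (f x)) S"
  using assms(3)
proof (induction k arbitrary: f)
  case 0
  then show ?case using bounded_linear.continuous_on[OF assms(1)] by auto
next
  case (Suc k)
  show ?case
    using Suc.IH Suc.prems
    by (intro Ck_onI[OF assms(2) bounded_linear.has_derivative[OF assms(1) Ck_on_has_derivative]])
       auto
qed

lemma Ck_on_mult:
  fixes f g :: "'e::euclidean_space \<Rightarrow> real"
  assumes "open S" "Ck_on k f S" "Ck_on k g S"
  shows "Ck_on k (\<lambda>x. f x * g x) S"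
  using assms(2,3)
proof (induction k arbitrary: f g)
  case 0
  then show ?case by (simp add: continuous_on_mult)
next
  case (Suc k)
  have "Ck_on k f S" "Ck_on k g S"
    using Suc.prems Ck_on_Suc_imp by blast+
  then show ?case
    using Suc.IH Suc.prems
    by (intro Ck_onI[OF assms(1) has_derivative_mult[OF Ck_on_has_derivative Ck_on_has_derivative]])
       (auto intro!: Ck_on_add assms(1))
qed

lemma Ck_on_sum:
  assumes "open S" "\<And>i. i \<in> I \<Longrightarrow> Ck_on k (f i) S"
  shows "Ck_on k (\<lambda>x. \<Sum>i\<in>I. f i x) S"
  using assms by (induction I rule: infinite_finite_induct) (auto intro: Ck_on_add)

lemma Ck_on_inverse:
  fixes f :: "'e::euclidean_space \<Rightarrow> real"
  assumes "open S" "Ck_on k f S" "\<And>x. x \<in> S \<Longrightarrow> f x \<noteq> 0"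
  shows "Ck_on k (\<lambda>x. inverse (f x)) S"
  using assms(2,3)
proof (induction k)
  case 0
  then show ?case by (simp add: continuous_on_inverse)
next
  case (Suc k)
  have "Ck_on k (\<lambda>x. inverse (f x)) S"
    using Suc Ck_on_Suc_imp by blast
  then have "Ck_on k (\<lambda>x. (- 1) * (inverse (f x) * frechet_derivative f (at x) v * inverse (f x))) S" for v
    using Suc.prems by (intro Ck_on_mult assms(1)) auto
  then show ?case
    using Suc.prems
    by (intro Ck_onI[OF assms(1) Deriv.has_derivative_inverse[OF _ Ck_on_has_derivative]]) auto
qed

lemma linear_eq_sum_Basis:
  fixes L :: "'e::euclidean_space \<Rightarrow> real"
  assumes "linear L"
  shows "L v = (\<Sum>b\<in>Basis. (v \<bullet> b) * L b)"
proof -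
  have "L v = L (\<Sum>b\<in>Basis. (v \<bullet> b) *\<^sub>R b)" by (simp add: euclidean_representation)
  then show ?thesis by (simp add: linear_sum[OF assms] linear_cmul[OF assms])
qed

lemma Ck_on_frechet_linear:
  fixes f :: "'e::euclidean_space \<Rightarrow> 'b::real_normed_vector"
  shows "Ck_on (Suc k) f S \<Longrightarrow> x \<in> S \<Longrightarrow> linear (frechet_derivative f (at x))"
  using Ck_on_has_derivative has_derivative_linear by blast

text \<open>The chain rule has to be written in coordinates, as a sum of products of real functions, for the
  induction on \<open>k\<close> to apply to each factor.\<close>

lemma Ck_on_compose:
  fixes f :: "'e::euclidean_space \<Rightarrow> real" and g :: "'d::euclidean_space \<Rightarrow> 'e"
  assumes "open S" "Ck_on k g S" "Ck_on k f T" "g ` S \<subseteq> T"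
  shows "Ck_on k (\<lambda>x. f (g x)) S"
  using assms(2,3)
proof (induction k arbitrary: f)
  case 0
  then show ?case using assms(4) continuous_on_compose2 by auto
next
  case (Suc k)
  have g: "Ck_on k g S" using Suc.prems Ck_on_Suc_imp by blast
  let ?f' = "\<lambda>x v. \<Sum>b\<in>Basis. (frechet_derivative g (at x) v \<bullet> b) * frechet_derivative f (at (g x)) b"
  show ?case
  proof (rule Ck_onI[OF assms(1), where f' = ?f'])
    fix x assume x: "x \<in> S"
    then have gx: "g x \<in> T" using assms(4) by auto
    have "((\<lambda>x. f (g x)) has_derivative (\<lambda>v. frechet_derivative f (at (g x)) (frechet_derivative g (at x) v))) (at x)"
      by (rule has_derivative_compose[OF Ck_on_has_derivative[OF Suc.prems(1) x] Ck_on_has_derivative[OF Suc.prems(2) gx]])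
    then show "((\<lambda>x. f (g x)) has_derivative ?f' x) (at x)"
      using linear_eq_sum_Basis[OF Ck_on_frechet_linear[OF Suc.prems(2) gx], of "frechet_derivative g (at x) v" for v] by simp
  next
    fix v
    show "Ck_on k (\<lambda>x. ?f' x v) S"
    proof (intro Ck_on_sum Ck_on_mult assms(1))
      fix b :: 'e assume "b \<in> Basis"
      show "Ck_on k (\<lambda>x. frechet_derivative g (at x) v \<bullet> b) S"
        using Suc.prems(1) by (intro Ck_on_linear_image[OF bounded_linear_inner_left] assms(1)) auto
      show "Ck_on k (\<lambda>x. frechet_derivative f (at (g x)) b) S"
        using Suc.IH[OF g] Suc.prems(2) by auto
    qed
  qed
qed

lemma smooth_on_Ck: "smooth_on f S \<Longrightarrow> Ck_on k f S"
  by (simp add: smooth_on_def)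

lemma smooth_on_differentiable:
  "smooth_on f S \<Longrightarrow> x \<in> S \<Longrightarrow> (f has_derivative frechet_derivative f (at x)) (at x)"
  using Ck_on_has_derivative smooth_on_Ck by blast

lemma smooth_on_continuous: "smooth_on f S \<Longrightarrow> continuous_on S f"
  using smooth_on_Ck[of f S 0] by simp

lemma smooth_on_derivative: "smooth_on f S \<Longrightarrow> smooth_on (\<lambda>x. frechet_derivative f (at x) v) S"
  unfolding smooth_on_def by (metis Ck_on.simps(2))

lemma smooth_on_cong:
  "open S \<Longrightarrow> (\<And>x. x \<in> S \<Longrightarrow> f x = g x) \<Longrightarrow> smooth_on f S \<Longrightarrow> smooth_on g S"
  unfolding smooth_on_def by (metis Ck_on_cong)

lemma smooth_on_subset: "smooth_on f S \<Longrightarrow> T \<subseteq> S \<Longrightarrow> smooth_on f T"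
  unfolding smooth_on_def by (metis Ck_on_subset)

lemma smooth_on_locally:
  "(\<And>x. x \<in> S \<Longrightarrow> \<exists>T. open T \<and> x \<in> T \<and> smooth_on f T) \<Longrightarrow> smooth_on f S"
  unfolding smooth_on_def by (metis Ck_on_locally)

lemma smooth_on_const [simp]: "smooth_on (\<lambda>x. c) S"
  by (simp add: smooth_on_def)

lemma smooth_on_add: "open S \<Longrightarrow> smooth_on f S \<Longrightarrow> smooth_on g S \<Longrightarrow> smooth_on (\<lambda>x. f x + g x) S"
  by (simp add: smooth_on_def Ck_on_add)

lemma smooth_on_mult:
  fixes f g :: "'e::euclidean_space \<Rightarrow> real"
  shows "open S \<Longrightarrow> smooth_on f S \<Longrightarrow> smooth_on g S \<Longrightarrow> smooth_on (\<lambda>x. f x * g x) S"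
  by (simp add: smooth_on_def Ck_on_mult)

lemma smooth_on_sum:
  "open S \<Longrightarrow> (\<And>i. i \<in> I \<Longrightarrow> smooth_on (f i) S) \<Longrightarrow> smooth_on (\<lambda>x. \<Sum>i\<in>I. f i x) S"
  by (simp add: smooth_on_def Ck_on_sum)

lemma smooth_on_inverse:
  fixes f :: "'e::euclidean_space \<Rightarrow> real"
  shows "open S \<Longrightarrow> smooth_on f S \<Longrightarrow> (\<And>x. x \<in> S \<Longrightarrow> f x \<noteq> 0) \<Longrightarrow> smooth_on (\<lambda>x. inverse (f x)) S"
  by (simp add: smooth_on_def Ck_on_inverse)

lemma smooth_on_compose:
  fixes f :: "'e::euclidean_space \<Rightarrow> real"
  shows "open S \<Longrightarrow> smooth_on g S \<Longrightarrow> smooth_on f T \<Longrightarrow> g ` S \<subseteq> T \<Longrightarrow> smooth_on (\<lambda>x. f (g x)) S"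
  by (auto simp: smooth_on_def intro: Ck_on_compose)

lemma smooth_on_linear:
  fixes L :: "'e::euclidean_space \<Rightarrow> 'b::real_normed_vector"
  assumes "bounded_linear L" "open S" shows "smooth_on L S"
proof -
  have "Ck_on k L S" for k
  proof (cases k)
    case 0
    then show ?thesis using assms(1) by (simp add: linear_continuous_on)
  next
    case (Suc k')
    have "Ck_on (Suc k') L S"
      by (rule Ck_onI[OF assms(2) bounded_linear.has_derivative[OF assms(1) has_derivative_ident]]) auto
    then show ?thesis using Suc by simp
  qed
  then show ?thesis by (simp add: smooth_on_def)
qed

section \<open>Bump functions and Hadamard's lemma in Euclidean space\<close>

text \<open>The functions \<open>exp (- 1 / t) / t ^ m\<close> on the positive half-line. The family over all \<open>m\<close> is closed
  under differentiation up to linear combinations, which makes smoothness of all of them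
  a single induction.\<close>

definition flat_exp :: "nat \<Rightarrow> real \<Rightarrow> real" where
  "flat_exp m t = (if t > 0 then exp (- inverse t) * inverse t ^ m else 0)"

lemma flat_exp_deriv:
  "(flat_exp m has_real_derivative flat_exp (m + 2) t - real m * flat_exp (m + 1) t) (at t)"
proof -
  \<comment> \<open>At 0 the difference quotient tends to 0 because exponential decay beats every power.\<close>
  consider "t > 0" | "t < 0" | "t = 0" by linarith
  then show ?thesis
  proof cases
    case 1
    have "((\<lambda>t. exp (- inverse t) * inverse t ^ m) has_real_derivative
        flat_exp (m + 2) t - real m * flat_exp (m + 1) t) (at t)"
      using 1 by (auto intro!: derivative_eq_intros simp: flat_exp_def power2_eq_square algebra_simps)
        (cases m; simp)
    then show ?thesis
      by (rule has_field_derivative_transform_within_open[of _ _ _ "{0<..}"]) (use 1 in \<open>auto simp: flat_exp_def\<close>)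
  next
    case 2
    have "((\<lambda>t. 0) has_real_derivative flat_exp (m + 2) t - real m * flat_exp (m + 1) t) (at t)"
      using 2 by (auto simp: flat_exp_def)
    then show ?thesis
      by (rule has_field_derivative_transform_within_open[of _ _ _ "{..<0}"]) (use 2 in \<open>auto simp: flat_exp_def\<close>)
  next
    case 3
    have "((\<lambda>t::real. inverse t ^ Suc m / exp (inverse t)) \<longlongrightarrow> 0) (at_right 0)"
      by (rule filterlim_compose[OF tendsto_power_div_exp_0 filterlim_inverse_at_top_right])
    then have R: "((\<lambda>h. (flat_exp m (0 + h) - flat_exp m 0) / h) \<longlongrightarrow> 0) (at_right 0)"
      by (rule Lim_transform_eventually)
         (auto simp: flat_exp_def exp_minus field_simps intro!: eventually_mono[OF eventually_at_right_less[of 0]])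
    have L: "((\<lambda>h. (flat_exp m (0 + h) - flat_exp m 0) / h) \<longlongrightarrow> 0) (at_left 0)"
      by (rule Lim_transform_eventually[OF tendsto_const])
         (auto simp: flat_exp_def eventually_at_filter)
    show ?thesis
      using 3 filterlim_split_at[OF L R] by (simp add: DERIV_def flat_exp_def)
  qed
qed

lemma smooth_flat_exp: "smooth_on (flat_exp m) UNIV"
proof -
  have "Ck_on k (flat_exp m) UNIV" for k
  proof (induction k arbitrary: m)
    case 0
    then show ?case using DERIV_isCont[OF flat_exp_deriv] by (simp add: continuous_on_eq_continuous_at)
  next
    case (Suc k)
    have "Ck_on k (\<lambda>x. (flat_exp (m + 2) x + (- real m) * flat_exp (m + 1) x) * v) UNIV" for v
      by (intro Ck_on_add Ck_on_mult Ck_on_const Suc open_UNIV)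
    then show ?case
      using flat_exp_deriv[of m, unfolded has_field_derivative_def]
      by (intro Ck_onI) auto
  qed
  then show ?thesis by (simp add: smooth_on_def)
qed

lemma smooth_ball_bump:
  fixes x0 :: "'e::euclidean_space"
  shows "smooth_on (\<lambda>x. flat_exp 0 (\<epsilon>\<^sup>2 - (x - x0) \<bullet> (x - x0))) UNIV"
proof -
  have lin: "smooth_on (\<lambda>x::'e. x \<bullet> b) UNIV" for b
    by (intro smooth_on_linear bounded_linear_inner_left) auto
  have "smooth_on (\<lambda>x. \<Sum>b\<in>B. (- 1) * ((x \<bullet> b + (- (x0 \<bullet> b))) * (x \<bullet> b + (- (x0 \<bullet> b))))) UNIV" for B
    by (intro smooth_on_sum smooth_on_mult smooth_on_add smooth_on_const lin open_UNIV)
  from smooth_on_add[OF open_UNIV smooth_on_const this[of Basis], of "\<epsilon>\<^sup>2"]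
  have "smooth_on (\<lambda>x. \<epsilon>\<^sup>2 - (x - x0) \<bullet> (x - x0)) UNIV"
    by (subst euclidean_inner) (simp add: inner_diff_left sum_negf)
  from smooth_on_compose[OF open_UNIV this smooth_flat_exp]
  show ?thesis by simp
qed

text \<open>The remainder terms of Hadamard's lemma. The weight \<open>t ^ m\<close> is there because each
  differentiation in \<open>x\<close> produces a factor \<open>t\<close>.\<close>

definition ray_integral :: "'e::euclidean_space \<Rightarrow> nat \<Rightarrow> ('e \<Rightarrow> real) \<Rightarrow> 'e \<Rightarrow> real" where
  "ray_integral p m f x = integral {0..1} (\<lambda>t. t ^ m * f (p + t *\<^sub>R (x - p)))"

lemma ray_in_convex:
  assumes "convex S" "p \<in> S" "x \<in> S" "t \<in> {0..1::real}"
  shows "p + t *\<^sub>R (x - p) \<in> S"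
proof -
  have "p + t *\<^sub>R (x - p) = (1 - t) *\<^sub>R p + t *\<^sub>R x" by (simp add: algebra_simps)
  then show ?thesis using assms convexD_alt[of S p x t] by auto
qed

lemma continuous_on_ray:
  fixes f :: "'e::euclidean_space \<Rightarrow> real"
  assumes "convex S" "p \<in> S" "continuous_on S f"
  shows "continuous_on (S \<times> {0..1}) (\<lambda>(x, t). t ^ m * f (p + t *\<^sub>R (x - p)))"
  unfolding case_prod_beta
  by (intro continuous_intros continuous_on_compose2[OF assms(3)])
     (use ray_in_convex[OF assms(1,2)] in auto)

lemma ray_integrable:
  fixes f :: "'e::euclidean_space \<Rightarrow> real"
  assumes "convex S" "p \<in> S" "continuous_on S f" "x \<in> S"
  shows "(\<lambda>t. t ^ m * f (p + t *\<^sub>R (x - p))) integrable_on {0..1}"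
  by (intro integrable_continuous_real continuous_intros continuous_on_compose2[OF assms(3)])
     (use ray_in_convex[OF assms(1,2,4)] in auto)

text \<open>Differentiation under the integral sign; the derivative is again a ray integral, of a derivative
  of \<open>f\<close>.\<close>

lemma ray_integral_has_derivative:
  fixes f :: "'e::euclidean_space \<Rightarrow> real"
  assumes S: "open S" "convex S" "p \<in> S" and f: "smooth_on f S" and x: "x \<in> S"
  shows "(ray_integral p m f has_derivative
    (\<lambda>v. ray_integral p (m + 1) (\<lambda>y. frechet_derivative f (at y) v) x)) (at x)"
proof -
  let ?\<gamma> = "\<lambda>x t. p + t *\<^sub>R (x - p)"
  define fx where "fx x t = (\<Sum>b\<in>Basis. (t ^ (m + 1) * frechet_derivative f (at (?\<gamma> x t)) b) *\<^sub>R blinfun_inner_left b)" for x t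
  have fx: "blinfun_apply (fx x t) v = t ^ (m + 1) * frechet_derivative f (at (?\<gamma> x t)) v"
    if "x \<in> S" "t \<in> {0..1}" for x t v
  proof -
    have "linear (frechet_derivative f (at (?\<gamma> x t)))"
      using smooth_on_differentiable[OF f ray_in_convex[OF S(2,3) that]] has_derivative_linear by blast
    from linear_eq_sum_Basis[OF this, of v] show ?thesis
      by (simp add: fx_def blinfun.sum_left blinfun.scaleR_left sum_distrib_left algebra_simps)
  qed
  have cont: "continuous_on (S \<times> cbox 0 1) (\<lambda>(x, t). fx x t)"
    using continuous_on_ray[OF S(2,3) smooth_on_continuous[OF smooth_on_derivative[OF f]], of "m + 1"]
    unfolding fx_def case_prod_beta
    by (intro continuous_on_sum continuous_on_scaleR continuous_on_const) simp
  have "((\<lambda>x. integral (cbox 0 1) (\<lambda>t. t ^ m * f (?\<gamma> x t))) has_derivative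
      blinfun_apply (integral (cbox 0 1) (fx x))) (at x within S)"
  proof (rule leibniz_rule[OF _ _ cont x S(2)])
    fix y and t :: real assume y: "y \<in> S" and t: "t \<in> cbox 0 1"
    then have yt: "?\<gamma> y t \<in> S" using ray_in_convex[OF S(2,3)] by simp
    have "((\<lambda>y. ?\<gamma> y t) has_derivative (\<lambda>v. t *\<^sub>R v)) (at y)"
      by (auto intro!: derivative_eq_intros)
    from has_derivative_compose[OF this smooth_on_differentiable[OF f yt]]
    have "((\<lambda>y. f (?\<gamma> y t)) has_derivative (\<lambda>v. frechet_derivative f (at (?\<gamma> y t)) (t *\<^sub>R v))) (at y)" .
    from has_derivative_mult_right[OF this, of "t ^ m"]
    moreover have "(\<lambda>v. t ^ m * frechet_derivative f (at (?\<gamma> y t)) (t *\<^sub>R v)) = blinfun_apply (fx y t)"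
      using linear_cmul[OF has_derivative_linear[OF smooth_on_differentiable[OF f yt]]] fx[OF y] t
      by (auto simp: fun_eq_iff)
    ultimately have "((\<lambda>y. t ^ m * f (?\<gamma> y t)) has_derivative blinfun_apply (fx y t)) (at y)"
      by simp
    then show "((\<lambda>y. t ^ m * f (?\<gamma> y t)) has_derivative blinfun_apply (fx y t)) (at y within S)"
      by (rule has_derivative_at_withinI)
  next
    fix y assume "y \<in> S"
    then show "(\<lambda>t. t ^ m * f (?\<gamma> y t)) integrable_on cbox 0 1"
      using ray_integrable[OF S(2,3) smooth_on_continuous[OF f]] by simp
  qed
  moreover have "blinfun_apply (integral (cbox 0 1) (fx x)) v
      = ray_integral p (m + 1) (\<lambda>y. frechet_derivative f (at y) v) x" for v
  proof -
    have "continuous_on {0..1} (\<lambda>t. (\<lambda>(x, t). fx x t) (x, t))"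
      by (rule continuous_on_compose2[OF cont]) (auto intro!: continuous_intros x)
    then have "fx x integrable_on {0..1}"
      by (auto intro: integrable_continuous_real)
    then show ?thesis
      unfolding ray_integral_def using fx[OF x]
      by (simp add: blinfun_apply_integral) (rule integral_cong, simp)
  qed
  then have "blinfun_apply (integral (cbox 0 1) (fx x))
      = (\<lambda>v. ray_integral p (m + 1) (\<lambda>y. frechet_derivative f (at y) v) x)"
    by blast
  ultimately show ?thesis
    using at_within_open[OF x S(1)] by (simp add: ray_integral_def[abs_def])
qed

lemma smooth_ray_integral:
  fixes f :: "'e::euclidean_space \<Rightarrow> real"
  assumes S: "open S" "convex S" "p \<in> S" and f: "smooth_on f S"
  shows "smooth_on (ray_integral p m f) S"
proof -
  have "Ck_on k (ray_integral p m f) S" for k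
    using f
  proof (induction k arbitrary: m f)
    case 0
    show ?case
      using integral_continuous_on_param[of S 0 "1::real", OF continuous_on_ray[OF S(2,3) smooth_on_continuous[OF 0], folded box_real], of m]
      by (simp add: ray_integral_def[abs_def])
  next
    case (Suc k)
    show ?case
      using Ck_onI[OF S(1) ray_integral_has_derivative[OF S Suc.prems] Suc.IH[OF smooth_on_derivative[OF Suc.prems]]] .
  qed
  then show ?thesis by (simp add: smooth_on_def)
qed

text \<open>Integrate the derivative of \<open>f\<close> along the segment from \<open>p\<close> to \<open>x\<close>. Unlike a Taylor estimate, this gives
  remainder factors that are themselves smooth, so that a derivation can be applied to the product.\<close>

lemma hadamard:
  fixes f :: "'e::euclidean_space \<Rightarrow> real"
  assumes S: "open S" "convex S" "p \<in> S" and f: "smooth_on f S"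
  obtains G where "\<And>b. smooth_on (G b) S" "\<And>b. G b p = frechet_derivative f (at p) b"
    "\<And>x. x \<in> S \<Longrightarrow> f x = f p + (\<Sum>b\<in>Basis. ((x - p) \<bullet> b) * G b x)"
proof
  let ?G = "\<lambda>b. ray_integral p 0 (\<lambda>y. frechet_derivative f (at y) b)"
  show "smooth_on (?G b) S" for b
    by (intro smooth_ray_integral S smooth_on_derivative f)
  show "?G b p = frechet_derivative f (at p) b" for b
    by (simp add: ray_integral_def)
  fix x assume x: "x \<in> S"
  let ?\<gamma> = "\<lambda>t. p + t *\<^sub>R (x - p)"
  have "((\<lambda>t. frechet_derivative f (at (?\<gamma> t)) (x - p)) has_integral f (?\<gamma> 1) - f (?\<gamma> 0)) {0..1}"
  proof (rule fundamental_theorem_of_calculus)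
    fix t :: real assume t: "t \<in> {0..1}"
    note D = smooth_on_differentiable[OF f ray_in_convex[OF S(2,3) x t]]
    have "(?\<gamma> has_derivative (\<lambda>s. s *\<^sub>R (x - p))) (at t)"
      by (auto intro!: derivative_eq_intros)
    from has_derivative_compose[OF this D] linear_cmul[OF has_derivative_linear[OF D]]
    show "((\<lambda>t. f (?\<gamma> t)) has_vector_derivative frechet_derivative f (at (?\<gamma> t)) (x - p)) (at t within {0..1})"
      by (simp add: has_vector_derivative_def has_derivative_at_withinI)
  qed simp
  then have "f x - f p = integral {0..1} (\<lambda>t. frechet_derivative f (at (?\<gamma> t)) (x - p))"
    by (simp add: integral_unique)
  also have "\<dots> = integral {0..1} (\<lambda>t. \<Sum>b\<in>Basis. ((x - p) \<bullet> b) * frechet_derivative f (at (?\<gamma> t)) b)"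
    by (intro integral_cong linear_eq_sum_Basis has_derivative_linear[OF smooth_on_differentiable[OF f ray_in_convex[OF S(2,3) x]]])
  also have "\<dots> = (\<Sum>b\<in>Basis. ((x - p) \<bullet> b) * ?G b x)"
    using ray_integrable[OF S(2,3) smooth_on_continuous[OF smooth_on_derivative[OF f]] x, of 0]
    by (subst integral_sum) (auto simp: ray_integral_def intro!: integrable_on_mult_right)
  finally show "f x = f p + (\<Sum>b\<in>Basis. ((x - p) \<bullet> b) * ?G b x)" by simp
qed

section \<open>Smooth functions on a manifold\<close>

lemma scaleR_fun_apply [simp]: "(c *\<^sub>R f) x = c *\<^sub>R f x"
  by (simp add: scaleR_fun_def)

lemma sum_fun_apply: "(\<Sum>i\<in>I. f i) x = (\<Sum>i\<in>I. f i x)"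
  by (induction I rule: infinite_finite_induct) auto

locale smooth_manifold =
  fixes A :: "('a::t2_space, 'e::euclidean_space) chart set"
  assumes atlas: "smooth_atlas A"
begin

lemma chart_at: obtains U \<phi> where "(U, \<phi>) \<in> A" "p \<in> U"
proof -
  have "p \<in> (\<Union>(U, \<phi>)\<in>A. U)" using atlas by (auto simp: smooth_atlas_def)
  then show ?thesis using that by auto
qed

context
  fixes U :: "'a set" and \<phi> :: "'a \<Rightarrow> 'e"
  assumes chart: "(U, \<phi>) \<in> A"
begin

lemma chart_homeomorphism: "homeomorphism U (\<phi> ` U) \<phi> (inv_into U \<phi>)"
  and chart_open: "open U" and chart_open_range: "open (\<phi> ` U)"
  using atlas chart by (auto simp: smooth_atlas_def is_chart_def)

lemma chart_inv [simp]: "q \<in> U \<Longrightarrow> inv_into U \<phi> (\<phi> q) = q"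
  using chart_homeomorphism by (auto simp: homeomorphism_def)

lemma chart_open_image: "open W \<Longrightarrow> open (\<phi> ` (U \<inter> W))"
  using homeomorphism_imp_open_map[OF chart_homeomorphism, of "U \<inter> W"] chart_open_range
  by (meson openin_open_Int openin_open_trans)

lemma chart_open_preimage: "open T \<Longrightarrow> open (U \<inter> \<phi> -` T)"
  using chart_homeomorphism chart_open by (simp add: homeomorphism_def continuous_on_open_vimage Int_commute)

lemma chart_transition:
  "(V, \<psi>) \<in> A \<Longrightarrow> smooth_on (\<psi> \<circ> inv_into U \<phi>) (\<phi> ` (U \<inter> V))"
  using atlas chart by (fastforce simp: smooth_atlas_def)

lemma smooth_fun_on_chart: "smooth_fun_on A W f \<Longrightarrow> smooth_on (f \<circ> inv_into U \<phi>) (\<phi> ` (U \<inter> W))"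
  using chart by (auto simp: smooth_fun_on_def)

end

text \<open>Smoothness in one chart implies smoothness in all the others, by composition with the transition
  maps.\<close>

lemma smooth_fun_onI_chart:
  assumes c: "(U, \<phi>) \<in> A" and W: "open W" "W \<subseteq> U" and f: "smooth_on (f \<circ> inv_into U \<phi>) (\<phi> ` W)"
  shows "smooth_fun_on A W f"
  unfolding smooth_fun_on_def
proof safe
  fix V \<psi> assume d: "(V, \<psi>) \<in> A"
  let ?T = "\<psi> ` (V \<inter> W)"
  have T: "open ?T" by (rule chart_open_image[OF d W(1)])
  have "smooth_on (\<phi> \<circ> inv_into V \<psi>) ?T"
    by (rule smooth_on_subset[OF chart_transition[OF d c]]) (use W(2) in auto)
  moreover have "(\<phi> \<circ> inv_into V \<psi>) ` ?T \<subseteq> \<phi> ` W" using chart_inv[OF d] by auto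
  ultimately have "smooth_on (\<lambda>x. (f \<circ> inv_into U \<phi>) ((\<phi> \<circ> inv_into V \<psi>) x)) ?T"
    using smooth_on_compose[OF T _ f] by blast
  then show "smooth_on (f \<circ> inv_into V \<psi>) ?T"
    by (rule smooth_on_cong[OF T, rotated]) (use W(2) chart_inv[OF d] chart_inv[OF c] in auto)
qed

lemma smooth_fun_on_subset: "smooth_fun_on A W f \<Longrightarrow> V \<subseteq> W \<Longrightarrow> smooth_fun_on A V f"
  unfolding smooth_fun_on_def by (fastforce intro: smooth_on_subset)

lemma smooth_fun_on_locally:
  assumes "\<And>p. p \<in> W \<Longrightarrow> \<exists>V. open V \<and> p \<in> V \<and> smooth_fun_on A V f"
  shows "smooth_fun_on A W f"
  unfolding smooth_fun_on_def
proof safe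
  fix U \<phi> assume c: "(U, \<phi>) \<in> A"
  show "smooth_on (f \<circ> inv_into U \<phi>) (\<phi> ` (U \<inter> W))"
  proof (rule smooth_on_locally)
    fix x assume "x \<in> \<phi> ` (U \<inter> W)"
    then obtain p where p: "p \<in> U" "p \<in> W" "x = \<phi> p" by auto
    then obtain V where V: "open V" "p \<in> V" "smooth_fun_on A V f" using assms by blast
    then show "\<exists>T. open T \<and> x \<in> T \<and> smooth_on (f \<circ> inv_into U \<phi>) T"
      using chart_open_image[OF c V(1)] smooth_fun_on_chart[OF c V(3)] p by blast
  qed
qed

lemma smooth_fun_on_cong:
  assumes "open W" "\<And>p. p \<in> W \<Longrightarrow> f p = h p" "smooth_fun_on A W f"
  shows "smooth_fun_on A W h"
  unfolding smooth_fun_on_def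
proof safe
  fix U \<phi> assume c: "(U, \<phi>) \<in> A"
  show "smooth_on (h \<circ> inv_into U \<phi>) (\<phi> ` (U \<inter> W))"
    by (rule smooth_on_cong[OF chart_open_image[OF c assms(1)] _ smooth_fun_on_chart[OF c assms(3)]])
       (use chart_inv[OF c] assms(2) in auto)
qed

lemma smooth_fun_on_const [simp]: "smooth_fun_on A W (\<lambda>p. c)"
  by (auto simp: smooth_fun_on_def o_def)

lemma smooth_fun_on_add:
  "open W \<Longrightarrow> smooth_fun_on A W f \<Longrightarrow> smooth_fun_on A W h \<Longrightarrow> smooth_fun_on A W (\<lambda>p. f p + h p)"
  using smooth_on_add[OF chart_open_image] by (fastforce simp: smooth_fun_on_def o_def)

lemma smooth_fun_on_mult:
  "open W \<Longrightarrow> smooth_fun_on A W f \<Longrightarrow> smooth_fun_on A W h \<Longrightarrow> smooth_fun_on A W (\<lambda>p. f p * h p)"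
  using smooth_on_mult[OF chart_open_image] by (fastforce simp: smooth_fun_on_def o_def)

lemma smooth_fun_on_inverse:
  "open W \<Longrightarrow> smooth_fun_on A W f \<Longrightarrow> (\<And>p. p \<in> W \<Longrightarrow> f p \<noteq> 0) \<Longrightarrow> smooth_fun_on A W (\<lambda>p. inverse (f p))"
  unfolding smooth_fun_on_def o_def
  by safe (rule smooth_on_inverse[OF chart_open_image], auto simp: chart_inv)

lemma smooth_fun_on_sum:
  "open W \<Longrightarrow> (\<And>i. i \<in> I \<Longrightarrow> smooth_fun_on A W (f i)) \<Longrightarrow> smooth_fun_on A W (\<lambda>p. \<Sum>i\<in>I. f i p)"
  by (induction I rule: infinite_finite_induct) (auto intro: smooth_fun_on_add)

lemma C_inf_imp_smooth_fun_on: "f \<in> C_inf A \<Longrightarrow> smooth_fun_on A W f"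
  unfolding C_inf_def using smooth_fun_on_subset by blast

lemma C_inf_const [simp]: "(\<lambda>p. c) \<in> C_inf A"
  and C_inf_add: "f \<in> C_inf A \<Longrightarrow> h \<in> C_inf A \<Longrightarrow> (\<lambda>p. f p + h p) \<in> C_inf A"
  and C_inf_mult: "f \<in> C_inf A \<Longrightarrow> h \<in> C_inf A \<Longrightarrow> (\<lambda>p. f p * h p) \<in> C_inf A"
  and C_inf_sum: "(\<And>i. i \<in> I \<Longrightarrow> F i \<in> C_inf A) \<Longrightarrow> (\<lambda>p. \<Sum>i\<in>I. F i p) \<in> C_inf A"
  by (auto simp: C_inf_def smooth_fun_on_add smooth_fun_on_mult smooth_fun_on_sum)

lemma C_inf_uminus: "f \<in> C_inf A \<Longrightarrow> (\<lambda>p. - f p) \<in> C_inf A"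
  using C_inf_mult[OF C_inf_const[of "-1"], of f] by simp

lemma C_inf_diff: "f \<in> C_inf A \<Longrightarrow> h \<in> C_inf A \<Longrightarrow> (\<lambda>p. f p - h p) \<in> C_inf A"
  using C_inf_add[OF _ C_inf_uminus, of f h] by simp

lemma C_inf_prod: "(\<And>i. i \<in> I \<Longrightarrow> F i \<in> C_inf A) \<Longrightarrow> (\<lambda>p. \<Prod>i\<in>I. F i p) \<in> C_inf A"
  by (induction I rule: infinite_finite_induct) (auto intro: C_inf_mult)

lemmas C_inf_intros = C_inf_const C_inf_add C_inf_mult C_inf_diff C_inf_uminus C_inf_sum C_inf_prod

lemma C_inf_continuous: "f \<in> C_inf A \<Longrightarrow> continuous_on UNIV f"
proof -
  assume f: "f \<in> C_inf A"
  have "isCont f p" for p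
  proof -
    obtain U \<phi> where c: "(U, \<phi>) \<in> A" "p \<in> U" by (rule chart_at)
    have "smooth_on (f \<circ> inv_into U \<phi>) (\<phi> ` U)"
      using smooth_fun_on_chart[OF c(1) C_inf_imp_smooth_fun_on[OF f], of UNIV] by simp
    then have "continuous_on (\<phi> ` U) (f \<circ> inv_into U \<phi>)"
      by (rule smooth_on_continuous)
    then have "continuous_on U (\<lambda>q. (f \<circ> inv_into U \<phi>) (\<phi> q))"
      by (rule continuous_on_compose2[OF _ homeomorphism_cont1[OF chart_homeomorphism[OF c(1)]] order_refl])
    then have "continuous_on U f"
      by (rule continuous_on_eq) (simp add: chart_inv[OF c(1)])
    then show ?thesis using chart_open[OF c(1)] c(2) continuous_on_eq_continuous_at by blast
  qed
  then show ?thesis by (simp add: continuous_on_eq_continuous_at)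
qed

lemma C_inf_open_support: "f \<in> C_inf A \<Longrightarrow> open {q. f q \<noteq> 0}"
  using C_inf_continuous[of f] open_Collect_neq[of f "\<lambda>_. 0"] by simp

text \<open>The closed set between the support and \<open>W\<close> is what allows functions and fields on \<open>W\<close>,
  multiplied by \<open>b\<close>, to be extended by zero.\<close>

definition bump_in :: "'a set \<Rightarrow> ('a \<Rightarrow> real) \<Rightarrow> bool" where
  "bump_in W b \<longleftrightarrow> b \<in> C_inf A \<and> (\<exists>C. closed C \<and> C \<subseteq> W \<and> (\<forall>q. q \<notin> C \<longrightarrow> b q = 0))"

lemma bump_inD: "bump_in W b \<Longrightarrow> b \<in> C_inf A" "bump_in W b \<Longrightarrow> q \<notin> W \<Longrightarrow> b q = 0"
  by (auto simp: bump_in_def)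

text \<open>Transport a Euclidean bump by a chart. It is supported in the image of a closed ball, which is
  compact and hence closed because the manifold is Hausdorff.\<close>

lemma bump_exists:
  assumes "open W" "p \<in> W"
  obtains b where "bump_in W b" "b p \<noteq> 0"
proof -
  obtain U \<phi> where c: "(U, \<phi>) \<in> A" "p \<in> U" by (rule chart_at)
  have "\<phi> p \<in> \<phi> ` (U \<inter> W)" using c assms by auto
  then obtain \<epsilon> where \<epsilon>: "\<epsilon> > 0" "cball (\<phi> p) \<epsilon> \<subseteq> \<phi> ` (U \<inter> W)"
    using chart_open_image[OF c(1) assms(1)] open_contains_cball by blast
  let ?h = "\<lambda>x. flat_exp 0 (\<epsilon>\<^sup>2 - (x - \<phi> p) \<bullet> (x - \<phi> p))"
  define b where "b q = (if q \<in> U then ?h (\<phi> q) else 0)" for q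
  define C where "C = inv_into U \<phi> ` cball (\<phi> p) \<epsilon>"
  have "compact C"
    unfolding C_def using chart_homeomorphism[OF c(1)] \<epsilon>(2)
    by (meson compact_cball compact_continuous_image continuous_on_subset homeomorphism_cont2 inf_le1 image_mono order_trans)
  then have C: "closed C" by (rule compact_imp_closed)
  have CW: "C \<subseteq> W \<inter> U" using \<epsilon>(2) chart_inv[OF c(1)] by (fastforce simp: C_def)
  have b0: "b q = 0" if "q \<notin> C" for q
  proof (cases "q \<in> U")
    case True
    have "\<phi> q \<notin> cball (\<phi> p) \<epsilon>" using that True chart_inv[OF c(1) True] by (metis C_def imageI)
    then have "\<epsilon> < norm (\<phi> q - \<phi> p)" by (simp add: dist_norm norm_minus_commute)
    then have "\<epsilon>\<^sup>2 < (norm (\<phi> q - \<phi> p))\<^sup>2" using \<epsilon>(1) by (intro power_strict_mono) auto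
    then show ?thesis by (simp add: b_def flat_exp_def dot_square_norm)
  qed (simp add: b_def)
  have 1: "smooth_fun_on A U b"
  proof (rule smooth_fun_onI_chart[OF c(1) chart_open[OF c(1)] order_refl])
    show "smooth_on (b \<circ> inv_into U \<phi>) (\<phi> ` U)"
      by (rule smooth_on_cong[OF chart_open_range[OF c(1)] _ smooth_on_subset[OF smooth_ball_bump subset_UNIV]])
         (auto simp: b_def chart_inv[OF c(1)])
  qed
  have 2: "smooth_fun_on A (- C) b"
    by (rule smooth_fun_on_cong[OF _ _ smooth_fun_on_const[of _ 0]]) (use C b0 in auto)
  have "b \<in> C_inf A"
    unfolding C_inf_def mem_Collect_eq
  proof (rule smooth_fun_on_locally)
    fix q
    show "\<exists>V. open V \<and> q \<in> V \<and> smooth_fun_on A V b"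
      using 1 2 C chart_open[OF c(1)] CW by (cases "q \<in> U") (auto intro: exI[of _ "- C"])
  qed
  then have "bump_in W b" using C CW b0 by (auto simp: bump_in_def)
  moreover have "b p \<noteq> 0" using c(2) \<epsilon>(1) by (simp add: b_def flat_exp_def)
  ultimately show ?thesis by (rule that)
qed

lemma C_inf_bump_extend:
  assumes W: "open W" and b: "bump_in W b" and f: "smooth_fun_on A W f"
  shows "(\<lambda>q. b q * (if q \<in> W then f q else 0)) \<in> C_inf A" (is "?F \<in> _")
proof -
  obtain C where C: "closed C" "C \<subseteq> W" "\<And>q. q \<notin> C \<Longrightarrow> b q = 0" using b by (auto simp: bump_in_def)
  have 1: "smooth_fun_on A W ?F"
    by (rule smooth_fun_on_cong[OF W _ smooth_fun_on_mult[OF W C_inf_imp_smooth_fun_on[OF bump_inD(1)[OF b]] f]]) auto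
  have 2: "smooth_fun_on A (- C) ?F"
    by (rule smooth_fun_on_cong[OF _ _ smooth_fun_on_const[of _ 0]]) (use C in auto)
  show ?thesis
    unfolding C_inf_def mem_Collect_eq
  proof (rule smooth_fun_on_locally)
    fix q
    show "\<exists>V. open V \<and> q \<in> V \<and> smooth_fun_on A V ?F"
      using 1 2 C W by (cases "q \<in> W") (auto intro: exI[of _ "- C"])
  qed
qed

section \<open>Tangent vectors and vector fields\<close>

lemma tangent_lincomb:
  "v \<in> tangent_space A p \<Longrightarrow> f \<in> C_inf A \<Longrightarrow> h \<in> C_inf A \<Longrightarrow> v (\<lambda>q. a * f q + b * h q) = a * v f + b * v h"
  and tangent_mult:
  "v \<in> tangent_space A p \<Longrightarrow> f \<in> C_inf A \<Longrightarrow> h \<in> C_inf A \<Longrightarrow> v (\<lambda>q. f q * h q) = f p * v h + h p * v f"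
  and tangent_not_smooth: "v \<in> tangent_space A p \<Longrightarrow> f \<notin> C_inf A \<Longrightarrow> v f = 0"
  by (simp_all add: tangent_space_def)

lemma tangent_add: "v \<in> tangent_space A p \<Longrightarrow> f \<in> C_inf A \<Longrightarrow> h \<in> C_inf A \<Longrightarrow> v (\<lambda>q. f q + h q) = v f + v h"
  using tangent_lincomb[of v p f h 1 1] by simp

lemma tangent_diff: "v \<in> tangent_space A p \<Longrightarrow> f \<in> C_inf A \<Longrightarrow> h \<in> C_inf A \<Longrightarrow> v (\<lambda>q. f q - h q) = v f - v h"
  using tangent_lincomb[of v p f h 1 "-1"] by simp

lemma tangent_const: assumes "v \<in> tangent_space A p" shows "v (\<lambda>q. c) = 0"
  using tangent_mult[OF assms C_inf_const C_inf_const, of 1 1] tangent_lincomb[OF assms C_inf_const C_inf_const, of c 1 0 1]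
  by simp

lemma tangent_sum:
  assumes "v \<in> tangent_space A p" "\<And>i. i \<in> I \<Longrightarrow> F i \<in> C_inf A"
  shows "v (\<lambda>q. \<Sum>i\<in>I. F i q) = (\<Sum>i\<in>I. v (F i))"
  using assms(2)
  by (induction I rule: infinite_finite_induct) (auto simp: tangent_const[OF assms(1)] tangent_add[OF assms(1)] C_inf_sum)

lemma tangent_eqI:
  "v \<in> tangent_space A p \<Longrightarrow> w \<in> tangent_space A p \<Longrightarrow> (\<And>f. f \<in> C_inf A \<Longrightarrow> v f = w f) \<Longrightarrow> v = w"
  by (rule ext) (metis tangent_not_smooth)

lemma subspace_tangent_space: "subspace (tangent_space A p)"
  unfolding subspace_def
  by (auto simp: tangent_space_def algebra_simps)

lemma tangent_space_0 [simp]: "0 \<in> tangent_space A p"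
  by (rule subspace_0[OF subspace_tangent_space])

lemma vfieldsI: "(\<And>p. X p \<in> tangent_space A p) \<Longrightarrow> (\<And>f. f \<in> C_inf A \<Longrightarrow> (\<lambda>p. X p f) \<in> C_inf A) \<Longrightarrow> X \<in> vfields A"
  by (auto simp: vfields_def smooth_vfield_on_def C_inf_def)

lemma vfields_tangent [simp]: "X \<in> vfields A \<Longrightarrow> X p \<in> tangent_space A p"
  by (auto simp: vfields_def smooth_vfield_on_def)

lemma vfields_C_inf:
  assumes X: "X \<in> vfields A"
  shows "(\<lambda>p. X p f) \<in> C_inf A"
proof (cases "f \<in> C_inf A")
  case True
  then have "smooth_fun_on A UNIV (\<lambda>p. X p f)"
    using X unfolding vfields_def smooth_vfield_on_def by blast
  then show ?thesis by (simp add: C_inf_def)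
next
  case False
  then show ?thesis by (simp add: tangent_not_smooth[OF vfields_tangent[OF X]])
qed

lemma vfields_0: "0 \<in> vfields A"
  by (rule vfieldsI) auto

lemma vfields_add: "X \<in> vfields A \<Longrightarrow> Y \<in> vfields A \<Longrightarrow> X + Y \<in> vfields A"
  by (rule vfieldsI) (auto intro: subspace_add[OF subspace_tangent_space] C_inf_add vfields_C_inf)

lemma vfields_scale: "f \<in> C_inf A \<Longrightarrow> X \<in> vfields A \<Longrightarrow> (\<lambda>p. f p *\<^sub>R X p) \<in> vfields A"
  by (rule vfieldsI) (auto intro: subspace_scale[OF subspace_tangent_space] C_inf_mult vfields_C_inf)

lemma vfields_diff: "X \<in> vfields A \<Longrightarrow> Y \<in> vfields A \<Longrightarrow> X - Y \<in> vfields A"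
  by (rule vfieldsI) (auto intro: subspace_diff[OF subspace_tangent_space] C_inf_diff vfields_C_inf)

text \<open>The second-order terms of \<open>X (Y f)\<close> and \<open>Y (X f)\<close> cancel in the product rule.\<close>

lemma lie_bracket_vfields:
  assumes X: "X \<in> vfields A" and Y: "Y \<in> vfields A"
  shows "lie_bracket X Y \<in> vfields A"
proof (rule vfieldsI)
  fix p
  note Xp = vfields_tangent[OF X] and Yp = vfields_tangent[OF Y]
  note s = vfields_C_inf[OF X] vfields_C_inf[OF Y]
  show "lie_bracket X Y p \<in> tangent_space A p"
    unfolding tangent_space_def mem_Collect_eq
  proof (intro conjI ballI allI impI)
    fix f h a b assume f: "f \<in> C_inf A" and h: "h \<in> C_inf A"
    show "lie_bracket X Y p (\<lambda>q. a * f q + b * h q) = a * lie_bracket X Y p f + b * lie_bracket X Y p h"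
      by (simp add: lie_bracket_def tangent_lincomb[OF Xp f h] tangent_lincomb[OF Yp f h]
          tangent_lincomb[OF Xp s(2) s(2)] tangent_lincomb[OF Yp s(1) s(1)] algebra_simps)
    show "lie_bracket X Y p (\<lambda>q. f q * h q) = f p * lie_bracket X Y p h + h p * lie_bracket X Y p f"
      by (simp add: lie_bracket_def tangent_mult[OF Xp f h] tangent_mult[OF Yp f h]
          tangent_add[OF Xp C_inf_mult C_inf_mult] tangent_add[OF Yp C_inf_mult C_inf_mult]
          tangent_mult[OF Xp] tangent_mult[OF Yp] f h s algebra_simps)
  next
    fix f assume "f \<notin> C_inf A"
    then show "lie_bracket X Y p f = 0"
      by (simp add: lie_bracket_def tangent_not_smooth[OF Xp] tangent_not_smooth[OF Yp] tangent_const[OF Xp] tangent_const[OF Yp])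
  qed
next
  fix f
  show "(\<lambda>p. lie_bracket X Y p f) \<in> C_inf A"
    unfolding lie_bracket_def by (intro C_inf_diff vfields_C_inf X Y)
qed

lemma vfields_bump_extend:
  assumes W: "open W" and b: "bump_in W b" and X: "smooth_vfield_on A W X"
  shows "(\<lambda>p. b p *\<^sub>R (if p \<in> W then X p else 0)) \<in> vfields A"
proof (rule vfieldsI)
  show "b p *\<^sub>R (if p \<in> W then X p else 0) \<in> tangent_space A p" for p
    using X by (intro subspace_scale[OF subspace_tangent_space]) (auto simp: smooth_vfield_on_def)
  fix f assume "f \<in> C_inf A"
  then have "smooth_fun_on A W (\<lambda>p. X p f)" using X by (auto simp: smooth_vfield_on_def)
  from C_inf_bump_extend[OF W b this]
  show "(\<lambda>p. (b p *\<^sub>R (if p \<in> W then X p else 0)) f) \<in> C_inf A"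
    by (rule back_subst[of "\<lambda>x. x \<in> C_inf A"]) auto
qed

section \<open>Coordinate fields span the tangent spaces\<close>

text \<open>The partial derivatives in a chart, with the value 0 on non-smooth functions that the
  representation of tangent vectors demands.\<close>

definition coord_field :: "'a set \<Rightarrow> ('a \<Rightarrow> 'e) \<Rightarrow> 'e \<Rightarrow> 'a vfield" where
  "coord_field U \<phi> i p f =
     (if f \<in> C_inf A then frechet_derivative (f \<circ> inv_into U \<phi>) (at (\<phi> p)) i else 0)"

context
  fixes U :: "'a set" and \<phi> :: "'a \<Rightarrow> 'e"
  assumes chart: "(U, \<phi>) \<in> A"
begin

lemma chart_rep_smooth: "f \<in> C_inf A \<Longrightarrow> smooth_on (f \<circ> inv_into U \<phi>) (\<phi> ` U)"
  using smooth_fun_on_chart[OF chart C_inf_imp_smooth_fun_on, of f UNIV] by simp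

lemma chart_rep_has_derivative:
  "f \<in> C_inf A \<Longrightarrow> p \<in> U \<Longrightarrow>
   (f \<circ> inv_into U \<phi> has_derivative (\<lambda>v. frechet_derivative (f \<circ> inv_into U \<phi>) (at (\<phi> p)) v)) (at (\<phi> p))"
  using smooth_on_differentiable[OF chart_rep_smooth] by blast

lemma coord_field_eq:
  assumes "f \<in> C_inf A" "(f \<circ> inv_into U \<phi> has_derivative D) (at (\<phi> p))"
  shows "coord_field U \<phi> i p f = D i"
  using assms frechet_derivative_at[OF assms(2)] by (simp add: coord_field_def)

lemma coord_field_tangent:
  assumes p: "p \<in> U"
  shows "coord_field U \<phi> i p \<in> tangent_space A p"
  unfolding tangent_space_def mem_Collect_eq
proof (intro conjI ballI allI impI)
  fix f h assume f: "f \<in> C_inf A" and h: "h \<in> C_inf A"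
  note D = chart_rep_has_derivative[OF f p] chart_rep_has_derivative[OF h p]
  note E = coord_field_eq[OF f D(1)] coord_field_eq[OF h D(2)]
  show "coord_field U \<phi> i p (\<lambda>q. a * f q + b * h q) = a * coord_field U \<phi> i p f + b * coord_field U \<phi> i p h" for a b
    unfolding E
    by (rule coord_field_eq)
       (auto intro!: C_inf_intros f h derivative_eq_intros D[unfolded o_def] simp: o_def)
  show "coord_field U \<phi> i p (\<lambda>q. f q * h q) = f p * coord_field U \<phi> i p h + h p * coord_field U \<phi> i p f"
    unfolding E
    by (rule coord_field_eq)
       (auto intro!: C_inf_intros f h derivative_eq_intros D[unfolded o_def] simp: o_def chart_inv[OF chart p])
qed (simp add: coord_field_def)

lemma coord_field_smooth: "smooth_vfield_on A U (coord_field U \<phi> i)"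
  unfolding smooth_vfield_on_def
proof (intro conjI ballI)
  fix f assume f: "f \<in> C_inf A"
  show "smooth_fun_on A U (\<lambda>p. coord_field U \<phi> i p f)"
  proof (rule smooth_fun_onI_chart[OF chart chart_open[OF chart] order_refl])
    show "smooth_on ((\<lambda>p. coord_field U \<phi> i p f) \<circ> inv_into U \<phi>) (\<phi> ` U)"
      by (rule smooth_on_cong[OF chart_open_range[OF chart] _ smooth_on_derivative[OF chart_rep_smooth[OF f]]])
         (auto simp: coord_field_def f chart_inv[OF chart])
  qed
qed (rule coord_field_tangent)

text \<open>By Hadamard's lemma \<open>f - f(p)\<close> is a sum of products of the coordinate functions, which vanish at \<open>p\<close>,
  with smooth factors whose values at \<open>p\<close> are the partial derivatives of \<open>f\<close>. Cutting off both factors with a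
  bump function \<open>b\<close> makes this an identity of global functions for \<open>b\<^sup>2 (f - f(p))\<close>, to which the
  derivation \<open>v\<close> applies; the coefficients of \<open>v\<close> are its values on the coordinate functions.\<close>

lemma coord_field_span:
  assumes p: "p \<in> U" and v: "v \<in> tangent_space A p"
  shows "\<exists>c. v = (\<Sum>i\<in>Basis. c i *\<^sub>R coord_field U \<phi> i p)"
proof -
  obtain \<epsilon> where \<epsilon>: "\<epsilon> > 0" "ball (\<phi> p) \<epsilon> \<subseteq> \<phi> ` U"
    using chart_open_range[OF chart] p open_contains_ball by blast
  let ?S = "ball (\<phi> p) \<epsilon>"
  define W where "W = U \<inter> \<phi> -` ?S"
  have W: "open W" "p \<in> W" using chart_open_preimage[OF chart] p \<epsilon>(1) by (auto simp: W_def)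
  have \<phi>W: "\<phi> ` W = ?S" using \<epsilon>(2) by (auto simp: W_def)
  have WU: "W \<subseteq> U" by (auto simp: W_def)
  obtain b where b: "bump_in W b" "b p \<noteq> 0" using bump_exists[OF W] .
  note bC = bump_inD(1)[OF b(1)]
  \<comment> \<open>The coordinate functions centred at p, and below the remainder factors, as global functions.\<close>
  define y where "y i q = b q * (if q \<in> W then (\<phi> q - \<phi> p) \<bullet> i else 0)" for i q
  have smooth: "smooth_fun_on A W (\<lambda>q. G (\<phi> q))" if "smooth_on G ?S" for G
    by (rule smooth_fun_onI_chart[OF chart W(1) WU], unfold \<phi>W, rule smooth_on_cong[OF open_ball _ that])
       (use \<epsilon>(2) in \<open>auto simp: f_inv_into_f subset_iff\<close>)
  have yC: "y i \<in> C_inf A" for i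
    unfolding y_def
    by (intro C_inf_bump_extend[OF W(1) b(1)] smooth)
       (use smooth_on_add[OF open_ball smooth_on_linear[OF bounded_linear_inner_left open_ball] smooth_on_const[of "- (\<phi> p \<bullet> i)"]] in \<open>simp add: inner_diff_left\<close>)
  have yp: "y i p = 0" for i by (simp add: y_def)
  have "v = (\<Sum>i\<in>Basis. (v (y i) / b p) *\<^sub>R coord_field U \<phi> i p)"
  proof (rule tangent_eqI[OF v])
    show "(\<Sum>i\<in>Basis. (v (y i) / b p) *\<^sub>R coord_field U \<phi> i p) \<in> tangent_space A p"
      by (intro subspace_sum[OF subspace_tangent_space] subspace_scale[OF subspace_tangent_space] coord_field_tangent p)
    fix f assume f: "f \<in> C_inf A"
    have sm: "smooth_on (f \<circ> inv_into U \<phi>) ?S"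
      using smooth_on_subset[OF chart_rep_smooth[OF f] \<epsilon>(2)] .
    have cen: "\<phi> p \<in> ?S" using \<epsilon>(1) by simp
    obtain G where G: "\<And>i. smooth_on (G i) ?S"
      "\<And>i. G i (\<phi> p) = frechet_derivative (f \<circ> inv_into U \<phi>) (at (\<phi> p)) i"
      "\<And>x. x \<in> ?S \<Longrightarrow> (f \<circ> inv_into U \<phi>) x = (f \<circ> inv_into U \<phi>) (\<phi> p) + (\<Sum>i\<in>Basis. ((x - \<phi> p) \<bullet> i) * G i x)"
      by (rule hadamard[OF open_ball convex_ball cen sm], rule that)
    define H where "H i q = b q * (if q \<in> W then G i (\<phi> q) else 0)" for i q
    have HC: "H i \<in> C_inf A" for i
      unfolding H_def by (intro C_inf_bump_extend[OF W(1) b(1)] smooth G)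
    have f_eq: "f q = f p + (\<Sum>i\<in>Basis. ((\<phi> q - \<phi> p) \<bullet> i) * G i (\<phi> q))" if "q \<in> W" for q
      using G(3)[of "\<phi> q"] that p chart_inv[OF chart] by (auto simp: W_def)
    \<comment> \<open>One factor b for the coordinate function and one for the remainder.\<close>
    have eq: "(\<lambda>q. (b q * b q) * (f q - f p)) = (\<lambda>q. \<Sum>i\<in>Basis. y i q * H i q)"
    proof
      fix q
      show "(b q * b q) * (f q - f p) = (\<Sum>i\<in>Basis. y i q * H i q)"
        using bump_inD(2)[OF b(1), of q] f_eq[of q]
        by (cases "q \<in> W") (auto simp: y_def H_def sum_distrib_left algebra_simps)
    qed
    have "b p * b p * v f = v (\<lambda>q. (b q * b q) * (f q - f p))"
      by (simp add: tangent_mult[OF v C_inf_mult[OF bC bC] C_inf_diff[OF f C_inf_const]]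
          tangent_diff[OF v f C_inf_const] tangent_const[OF v])
    also have "\<dots> = (\<Sum>i\<in>Basis. H i p * v (y i))"
      unfolding eq by (simp add: tangent_sum[OF v C_inf_mult[OF yC HC]] tangent_mult[OF v yC HC] yp)
    also have "\<dots> = b p * (\<Sum>i\<in>Basis. coord_field U \<phi> i p f * v (y i))"
      using W(2) f by (simp add: H_def G(2) coord_field_def sum_distrib_left algebra_simps)
    finally have "v f = (\<Sum>i\<in>Basis. coord_field U \<phi> i p f * v (y i)) / b p"
      using b(2) by (simp add: field_simps)
    then show "v f = (\<Sum>i\<in>Basis. (v (y i) / b p) *\<^sub>R coord_field U \<phi> i p) f"
      by (simp add: sum_fun_apply sum_divide_distrib mult.commute)
  qed
  then show ?thesis by (intro exI[of _ "\<lambda>i. v (y i) / b p"])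
qed

text \<open>The coordinate fields are separated by the coordinate functions, cut off by a bump function.\<close>

lemma coord_field_independent:
  assumes p: "p \<in> U" and c: "(\<Sum>i\<in>Basis. c i *\<^sub>R coord_field U \<phi> i p) = 0" and j: "j \<in> Basis"
  shows "c j = 0"
proof -
  obtain b where b: "bump_in U b" "b p \<noteq> 0" using bump_exists[OF chart_open[OF chart] p] .
  note bC = bump_inD(1)[OF b(1)]
  define y where "y q = b q * (if q \<in> U then (\<phi> q - \<phi> p) \<bullet> j else 0)" for q
  have y: "y \<in> C_inf A"
    unfolding y_def
  proof (rule C_inf_bump_extend[OF chart_open[OF chart] b(1)], rule smooth_fun_onI_chart[OF chart chart_open[OF chart] order_refl])
    show "smooth_on ((\<lambda>q. (\<phi> q - \<phi> p) \<bullet> j) \<circ> inv_into U \<phi>) (\<phi> ` U)"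
      by (rule smooth_on_cong[OF chart_open_range[OF chart] _ smooth_on_add[OF chart_open_range[OF chart] 
            smooth_on_linear[OF bounded_linear_inner_left chart_open_range[OF chart]] smooth_on_const[of "- (\<phi> p \<bullet> j)"]]])
         (auto simp: chart_inv[OF chart] inner_diff_left)
  qed
  have "((\<lambda>x. (b \<circ> inv_into U \<phi>) x * ((x - \<phi> p) \<bullet> j)) has_derivative (\<lambda>v. b p * (v \<bullet> j))) (at (\<phi> p))"
    using chart_inv[OF chart p]
    by (auto intro!: derivative_eq_intros chart_rep_has_derivative[OF bC p, unfolded o_def] simp: o_def)
  then have "(y \<circ> inv_into U \<phi> has_derivative (\<lambda>v. b p * (v \<bullet> j))) (at (\<phi> p))"
    by (rule has_derivative_transform_within_open[OF _ chart_open_range[OF chart]])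
       (use p chart_inv[OF chart] in \<open>auto simp: y_def\<close>)
  then have "coord_field U \<phi> i p y = b p * (i \<bullet> j)" for i
    using coord_field_eq[OF y] by blast
  then have "(\<Sum>i\<in>Basis. c i *\<^sub>R coord_field U \<phi> i p) y = (\<Sum>i\<in>Basis. if i = j then c i * b p else 0)"
    unfolding sum_fun_apply by (intro sum.cong) (auto simp: j inner_Basis)
  then show ?thesis using c j b(2) by simp
qed

end

text \<open>This makes every result on distributions applicable to the tangent bundle itself.\<close>

lemma distribution_tangent_space: "distribution A DIM('e) (tangent_space A)"
  unfolding distribution_def
proof
  fix p
  obtain U \<phi> where c: "(U, \<phi>) \<in> A" "p \<in> U" by (rule chart_at)
  obtain e where e: "bij_betw e {..<DIM('e)} (Basis :: 'e set)"
    using ex_bij_betw_nat_finite[OF finite_Basis] by (auto simp: atLeast0LessThan)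
  have im: "(\<lambda>i. coord_field U \<phi> (e i) q) ` {..<DIM('e)} = (\<lambda>i. coord_field U \<phi> i q) ` Basis" for q
    using e image_image[of "\<lambda>i. coord_field U \<phi> i q" e "{..<DIM('e)}"] by (simp add: bij_betw_def)
  have inj: "inj_on (\<lambda>i. coord_field U \<phi> i q) Basis" if q: "q \<in> U" for q
  proof (rule inj_onI, rule ccontr)
    fix i j :: 'e assume ij: "i \<in> Basis" "j \<in> Basis" "coord_field U \<phi> i q = coord_field U \<phi> j q" "i \<noteq> j"
    define c where "c k = (if k = i then 1 else 0) - (if k = j then 1 else 0 :: real)" for k
    have "(\<Sum>k\<in>Basis. c k *\<^sub>R coord_field U \<phi> k q) = 0"
      using ij by (simp add: c_def scaleR_diff_left sum_subtractf if_distrib[of "\<lambda>c. c *\<^sub>R _"] cong: if_cong)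
    from coord_field_independent[OF c(1) q this ij(1)] ij(4) show False by (simp add: c_def)
  qed
  show "\<exists>W F. open W \<and> p \<in> W \<and> (\<forall>i<DIM('e). smooth_vfield_on A W (F i)) \<and>
      (\<forall>q\<in>W. inj_on (\<lambda>i. F i q) {..<DIM('e)} \<and> independent ((\<lambda>i. F i q) ` {..<DIM('e)}) \<and>
        span ((\<lambda>i. F i q) ` {..<DIM('e)}) = tangent_space A q)"
  proof (intro exI[of _ U] exI[of _ "\<lambda>i. coord_field U \<phi> (e i)"] conjI ballI allI impI)
    show "open U" "p \<in> U" using c chart_open by auto
    show "smooth_vfield_on A U (coord_field U \<phi> (e i))" for i by (rule coord_field_smooth[OF c(1)])
    fix q assume q: "q \<in> U"
    show "inj_on (\<lambda>i. coord_field U \<phi> (e i) q) {..<DIM('e)}"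
      using comp_inj_on[of e "{..<DIM('e)}" "\<lambda>i. coord_field U \<phi> i q"] e inj[OF q] by (simp add: bij_betw_def o_def)
    show "independent ((\<lambda>i. coord_field U \<phi> (e i) q) ` {..<DIM('e)})"
      unfolding im
    proof
      assume "dependent ((\<lambda>i. coord_field U \<phi> i q) ` Basis)"
      then obtain f i where i: "i \<in> Basis" "f (coord_field U \<phi> i q) \<noteq> 0"
        and "(\<Sum>v\<in>(\<lambda>i. coord_field U \<phi> i q) ` Basis. f v *\<^sub>R v) = 0"
        by (auto simp: dependent_finite)
      then have "(\<Sum>i\<in>Basis. f (coord_field U \<phi> i q) *\<^sub>R coord_field U \<phi> i q) = 0"
        by (simp add: sum.reindex[OF inj[OF q]])
      then have "f (coord_field U \<phi> i q) = 0"
        using coord_field_independent[OF c(1) q, where c = "\<lambda>i. f (coord_field U \<phi> i q)"] i(1) by simp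
      with i(2) show False by simp
    qed
    show "span ((\<lambda>i. coord_field U \<phi> (e i) q) ` {..<DIM('e)}) = tangent_space A q"
      unfolding im
    proof
      show "span ((\<lambda>i. coord_field U \<phi> i q) ` Basis) \<subseteq> tangent_space A q"
        by (rule span_minimal[OF _ subspace_tangent_space]) (use coord_field_tangent[OF c(1) q] in auto)
      show "tangent_space A q \<subseteq> span ((\<lambda>i. coord_field U \<phi> i q) ` Basis)"
      proof
        fix v assume "v \<in> tangent_space A q"
        then obtain a where "v = (\<Sum>i\<in>Basis. a i *\<^sub>R coord_field U \<phi> i q)"
          using coord_field_span[OF c(1) q] by metis
        then show "v \<in> span ((\<lambda>i. coord_field U \<phi> i q) ` Basis)"
          by (simp only:) (intro span_sum span_scale span_base imageI)
      qed
    qed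
  qed
qed

end

section \<open>Metric algebra and Gram-Schmidt orthogonalization\<close>

lemma span_image_scaleR:
  fixes F :: "'i \<Rightarrow> 'v::real_vector"
  assumes "c \<noteq> 0"
  shows "span ((\<lambda>i. c *\<^sub>R F i) ` I) = span (F ` I)"
proof
  show "span ((\<lambda>i. c *\<^sub>R F i) ` I) \<subseteq> span (F ` I)"
    by (rule span_minimal[OF _ subspace_span]) (auto intro: span_scale span_base)
  have "F i \<in> span ((\<lambda>i. c *\<^sub>R F i) ` I)" if "i \<in> I" for i
    using span_scale[OF span_base[OF imageI[OF that]], of "inverse c" "\<lambda>i. c *\<^sub>R F i"] assms by simp
  then show "span (F ` I) \<subseteq> span ((\<lambda>i. c *\<^sub>R F i) ` I)"
    by (intro span_minimal[OF _ subspace_span]) auto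
qed

context smooth_manifold
begin

lemma vfields_sum: "(\<And>i. i \<in> I \<Longrightarrow> X i \<in> vfields A) \<Longrightarrow> (\<lambda>p. \<Sum>i\<in>I. X i p) \<in> vfields A"
proof (induction I rule: infinite_finite_induct)
  case (insert i I)
  then have "X i + (\<lambda>p. \<Sum>i\<in>I. X i p) \<in> vfields A" by (auto intro: vfields_add)
  then show ?case using insert.hyps by (simp add: plus_fun_def)
qed (use vfields_0 in \<open>auto simp: zero_fun_def\<close>)

end

locale riemannian_manifold = smooth_manifold A
  for A :: "('a::t2_space, 'e::euclidean_space) chart set" +
  fixes g :: "'a tensor2"
  assumes metric: "riemannian_metric A g"
begin

lemma g_lincomb:
  "u \<in> tangent_space A p \<Longrightarrow> v \<in> tangent_space A p \<Longrightarrow> w \<in> tangent_space A p \<Longrightarrow>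
   g p (a *\<^sub>R u + b *\<^sub>R v) w = a * g p u w + b * g p v w"
  and g_sym: "u \<in> tangent_space A p \<Longrightarrow> v \<in> tangent_space A p \<Longrightarrow> g p u v = g p v u"
  and g_pos: "u \<in> tangent_space A p \<Longrightarrow> u \<noteq> 0 \<Longrightarrow> g p u u > 0"
  and g_C_inf: "X \<in> vfields A \<Longrightarrow> Y \<in> vfields A \<Longrightarrow> (\<lambda>p. g p (X p) (Y p)) \<in> C_inf A"
  using metric unfolding riemannian_metric_def by blast+

lemma g_add_left: "u \<in> tangent_space A p \<Longrightarrow> v \<in> tangent_space A p \<Longrightarrow> w \<in> tangent_space A p \<Longrightarrow>
    g p (u + v) w = g p u w + g p v w"
  using g_lincomb[of u p v w 1 1] by simp

lemma g_diff_left: "u \<in> tangent_space A p \<Longrightarrow> v \<in> tangent_space A p \<Longrightarrow> w \<in> tangent_space A p \<Longrightarrow>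
    g p (u - v) w = g p u w - g p v w"
  using g_lincomb[of u p v w 1 "-1"] by simp

lemma g_scale_left: "u \<in> tangent_space A p \<Longrightarrow> w \<in> tangent_space A p \<Longrightarrow> g p (c *\<^sub>R u) w = c * g p u w"
  using g_lincomb[of u p u w c 0] by simp

lemma g_zero_left [simp]: "w \<in> tangent_space A p \<Longrightarrow> g p 0 w = 0"
  using g_scale_left[of 0 p w 0] by simp

lemma g_add_right: "u \<in> tangent_space A p \<Longrightarrow> v \<in> tangent_space A p \<Longrightarrow> w \<in> tangent_space A p \<Longrightarrow>
    g p w (u + v) = g p w u + g p w v"
  using g_add_left[of u p v w] by (simp add: g_sym subspace_add[OF subspace_tangent_space])

lemma g_diff_right: "u \<in> tangent_space A p \<Longrightarrow> v \<in> tangent_space A p \<Longrightarrow> w \<in> tangent_space A p \<Longrightarrow>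
    g p w (u - v) = g p w u - g p w v"
  using g_diff_left[of u p v w] by (simp add: g_sym subspace_diff[OF subspace_tangent_space])

lemma g_scale_right: "u \<in> tangent_space A p \<Longrightarrow> w \<in> tangent_space A p \<Longrightarrow> g p w (c *\<^sub>R u) = c * g p w u"
  using g_scale_left[of u p w c] by (simp add: g_sym subspace_scale[OF subspace_tangent_space])

lemma g_sum_left:
  assumes "\<And>i. i \<in> I \<Longrightarrow> u i \<in> tangent_space A p" "w \<in> tangent_space A p"
  shows "g p (\<Sum>i\<in>I. u i) w = (\<Sum>i\<in>I. g p (u i) w)"
  using assms
  by (induction I rule: infinite_finite_induct) (auto simp: g_add_left subspace_sum[OF subspace_tangent_space])

lemma g_eq_0_iff: "u \<in> tangent_space A p \<Longrightarrow> g p u u = 0 \<longleftrightarrow> u = 0"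
  by (metis g_pos g_zero_left less_irrefl)

lemma orthogonal_expansion:
  fixes r :: nat
  assumes u: "\<And>i. i < r \<Longrightarrow> u i \<in> tangent_space A p" "\<And>i. i < r \<Longrightarrow> u i \<noteq> 0"
    and orth: "\<And>i j. i < r \<Longrightarrow> j < r \<Longrightarrow> i \<noteq> j \<Longrightarrow> g p (u i) (u j) = 0"
    and v: "v \<in> span (u ` {..<r})"
  shows "v = (\<Sum>i<r. (g p v (u i) / g p (u i) (u i)) *\<^sub>R u i)"
proof -
  let ?T = "tangent_space A p"
  define e where "e v = (\<Sum>i<r. (g p v (u i) / g p (u i) (u i)) *\<^sub>R u i)" for v
  have "subspace {v \<in> ?T. v = e v}"
    unfolding subspace_def
  proof (intro conjI ballI allI)
    show "0 \<in> {v \<in> ?T. v = e v}" using u(1) by (simp add: e_def)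
    fix x y c assume x: "x \<in> {v \<in> ?T. v = e v}" and y: "y \<in> {v \<in> ?T. v = e v}"
    have "e (x + y) = e x + e y"
      using x y u(1) by (simp add: e_def g_add_left add_divide_distrib scaleR_left.add sum.distrib)
    then show "x + y \<in> {v \<in> ?T. v = e v}" using x y subspace_add[OF subspace_tangent_space] by auto
    have "e (c *\<^sub>R x) = c *\<^sub>R e x"
      unfolding e_def scaleR_sum_right using x u(1) by (intro sum.cong) (auto simp: g_scale_left)
    then show "c *\<^sub>R x \<in> {v \<in> ?T. v = e v}" using x subspace_scale[OF subspace_tangent_space] by auto
  qed
  moreover have "u j = e (u j)" if j: "j < r" for j
  proof -
    have "e (u j) = (\<Sum>i<r. if i = j then u i else 0)"
      unfolding e_def using orth[OF j] u j by (intro sum.cong) (auto simp: g_eq_0_iff)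
    then show ?thesis using j by simp
  qed
  ultimately have "span (u ` {..<r}) \<subseteq> {v \<in> ?T. v = e v}"
    using u(1) by (intro span_minimal) auto
  then show ?thesis using v by (auto simp: e_def)
qed

text \<open>Gram-Schmidt with cleared denominators: with \<open>n i = g(G i, G i)\<close>, the new vector is
  \<open>(\<Prod>i<r. n i) F r - (\<Sum>j<r. (\<Prod>i\<noteq>j. n i) g(F r, G j) G j)\<close>. No division occurs, so the orthogonal
  fields are globally smooth even where the given ones become dependent, and the span is
  preserved where they are independent.\<close>

lemma gram_schmidt:
  fixes r :: nat
  assumes "\<And>i. i < r \<Longrightarrow> F i \<in> vfields A"
    and "\<And>p k. p \<in> W \<Longrightarrow> k < r \<Longrightarrow> F k p \<notin> span ((\<lambda>j. F j p) ` {..<k})"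
  obtains G where "\<And>i. i < r \<Longrightarrow> G i \<in> vfields A"
    "\<And>i j p. i < r \<Longrightarrow> j < r \<Longrightarrow> i \<noteq> j \<Longrightarrow> g p (G i p) (G j p) = 0"
    "\<And>i p. i < r \<Longrightarrow> G i p \<in> span ((\<lambda>j. F j p) ` {..<r})"
    "\<And>i p. p \<in> W \<Longrightarrow> i < r \<Longrightarrow> G i p \<noteq> 0"
    "\<And>p. p \<in> W \<Longrightarrow> span ((\<lambda>j. G j p) ` {..<r}) = span ((\<lambda>j. F j p) ` {..<r})"
  using assms
proof (induction r arbitrary: thesis)
  case 0
  show ?case by (rule "0.prems"(1)[of F]) auto
next
  case (Suc r)
  have F: "\<And>i. i < r \<Longrightarrow> F i \<in> vfields A"
    "\<And>p k. p \<in> W \<Longrightarrow> k < r \<Longrightarrow> F k p \<notin> span ((\<lambda>j. F j p) ` {..<k})"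
    using Suc.prems(2,3) by auto
  obtain G where G: "\<And>i. i < r \<Longrightarrow> G i \<in> vfields A"
    and orth: "\<And>i j p. i < r \<Longrightarrow> j < r \<Longrightarrow> i \<noteq> j \<Longrightarrow> g p (G i p) (G j p) = 0"
    and GF: "\<And>i p. i < r \<Longrightarrow> G i p \<in> span ((\<lambda>j. F j p) ` {..<r})"
    and GW: "\<And>i p. p \<in> W \<Longrightarrow> i < r \<Longrightarrow> G i p \<noteq> 0"
    and sp: "\<And>p. p \<in> W \<Longrightarrow> span ((\<lambda>j. G j p) ` {..<r}) = span ((\<lambda>j. F j p) ` {..<r})"
    by (rule Suc.IH[OF _ F], rule that)
  have Fr: "F r \<in> vfields A" using Suc.prems by simp
  define n where "n i p = g p (G i p) (G i p)" for i p
  define N where "N p = (\<Prod>i<r. n i p)" for p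
  define a where "a j p = (\<Prod>i\<in>{..<r} - {j}. n i p) * g p (F r p) (G j p)" for j p
  define S where "S p = (\<Sum>j<r. a j p *\<^sub>R G j p)" for p
  define H where "H p = N p *\<^sub>R F r p - S p" for p
  have nC: "n i \<in> C_inf A" if "i < r" for i
    using g_C_inf[OF G[OF that] G[OF that]] by (simp add: n_def[abs_def])
  have aC: "a j \<in> C_inf A" if "j < r" for j
    unfolding a_def[abs_def] using nC by (intro C_inf_mult C_inf_prod g_C_inf Fr G that) auto
  have SV: "S \<in> vfields A"
    unfolding S_def[abs_def] using aC G by (intro vfields_sum vfields_scale) auto
  have HV: "H \<in> vfields A"
    using vfields_diff[OF vfields_scale[OF _ Fr] SV, of N] C_inf_prod[of "{..<r}" n] nC
    by (simp add: H_def[abs_def] N_def[abs_def] fun_diff_def)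
  have HG: "g p (H p) (G k p) = 0" if k: "k < r" for k p
  proof -
    note T = vfields_tangent[OF G] vfields_tangent[OF Fr] vfields_tangent[OF SV]
    have "g p (S p) (G k p) = (\<Sum>j<r. a j p * g p (G j p) (G k p))"
      unfolding S_def using k
      by (subst g_sum_left) (auto simp: T g_scale_left subspace_scale[OF subspace_tangent_space])
    also have "\<dots> = (\<Sum>j<r. if j = k then a k p * n k p else 0)"
      by (intro sum.cong) (auto simp: n_def orth k)
    also have "\<dots> = N p * g p (F r p) (G k p)"
      using k prod.remove[of "{..<r}" k "\<lambda>i. n i p"] by (simp add: a_def N_def)
    finally show ?thesis
      unfolding H_def using k by (simp add: T g_diff_left g_scale_left subspace_scale[OF subspace_tangent_space])
  qed
  let ?F = "\<lambda>k p. span ((\<lambda>j. F j p) ` {..<k})"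
  have "?F r p \<subseteq> ?F (Suc r) p" for p by (rule span_mono) auto
  then have mono: "x \<in> ?F r p \<Longrightarrow> x \<in> ?F (Suc r) p" for x p by blast
  have SF: "S p \<in> ?F r p" for p
    unfolding S_def using GF by (intro span_sum span_scale) auto
  have FF: "F r p \<in> ?F (Suc r) p" for p by (intro span_base) auto
  have HF: "H p \<in> ?F (Suc r) p" for p
    unfolding H_def by (intro span_diff span_scale FF mono SF)
  have N0: "N p \<noteq> 0" if "p \<in> W" for p
    using GW[OF that] G by (simp add: N_def n_def g_eq_0_iff)
  have H0: "H p \<noteq> 0" if p: "p \<in> W" for p
  proof
    assume "H p = 0"
    then have "S p = N p *\<^sub>R F r p" by (simp add: H_def)
    then have "F r p = inverse (N p) *\<^sub>R S p" using N0[OF p] by simp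
    also have "\<dots> \<in> ?F r p" by (intro span_scale SF)
    finally show False using Suc.prems(3)[OF p, of r] by simp
  qed
  define G' where "G' = G(r := H)"
  have G'k: "G' k = G k" if "k < r" for k using that by (simp add: G'_def)
  have G'r: "G' r = H" by (simp add: G'_def)
  have spS: "span ((\<lambda>j. G' j p) ` {..<Suc r}) = ?F (Suc r) p" if p: "p \<in> W" for p
  proof
    show "span ((\<lambda>j. G' j p) ` {..<Suc r}) \<subseteq> ?F (Suc r) p"
      using mono[OF GF] HF by (intro span_minimal[OF _ subspace_span]) (auto simp: less_Suc_eq G'k G'r)
    have "G j p \<in> (\<lambda>j. G' j p) ` {..<Suc r}" if "j < r" for j
      using that by (intro image_eqI[of _ _ j]) (auto simp: G'k)
    then have "(\<lambda>j. G j p) ` {..<r} \<subseteq> (\<lambda>j. G' j p) ` {..<Suc r}" by auto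
    then have sub: "x \<in> ?F r p \<Longrightarrow> x \<in> span ((\<lambda>j. G' j p) ` {..<Suc r})" for x
      using span_mono sp[OF p] by blast
    have "H p \<in> span ((\<lambda>j. G' j p) ` {..<Suc r})" by (intro span_base) (auto simp: G'r intro!: image_eqI[of _ _ r])
    moreover have "F r p = inverse (N p) *\<^sub>R (H p + S p)" using N0[OF p] by (simp add: H_def)
    ultimately have "F r p \<in> span ((\<lambda>j. G' j p) ` {..<Suc r})"
      using sub[OF SF] by (auto intro!: span_scale span_add)
    moreover have "F k p \<in> span ((\<lambda>j. G' j p) ` {..<Suc r})" if "k < r" for k
      using that by (intro sub span_base) auto
    ultimately show "?F (Suc r) p \<subseteq> span ((\<lambda>j. G' j p) ` {..<Suc r})"
      by (intro span_minimal[OF _ subspace_span]) (auto simp: less_Suc_eq)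
  qed
  have orth': "g p (G' i p) (G' j p) = 0" if ij: "i < Suc r" "j < Suc r" "i \<noteq> j" for i j p
  proof (cases "i = r")
    case True
    then show ?thesis using ij HG[of j p] by (simp add: G'r G'k)
  next
    case False
    then show ?thesis
      using ij orth HG[of i p] g_sym[OF vfields_tangent[OF HV] vfields_tangent[OF G]]
      by (cases "j = r") (auto simp: G'r G'k)
  qed
  show ?case
  proof (rule Suc.prems(1)[of G'])
    show "G' i p \<in> ?F (Suc r) p" if "i < Suc r" for i p
      using that mono[OF GF] HF by (cases "i = r") (auto simp: G'k G'r less_Suc_eq)
    show "G' i p \<noteq> 0" if "p \<in> W" "i < Suc r" for i p
      using that GW H0 by (cases "i = r") (auto simp: G'k G'r less_Suc_eq)
  qed (use G HV orth' spS in \<open>auto simp: less_Suc_eq G'k G'r\<close>)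
qed

end

section \<open>Riesz representation for sections of a distribution\<close>

locale riemannian_distribution = riemannian_manifold A g
  for A :: "('a::t2_space, 'e::euclidean_space) chart set" and g +
  fixes E :: "'a \<Rightarrow> 'a tvec set" and r :: nat
  assumes dist: "distribution A r E"
begin

lemma subspace_E: "subspace (E p)"
  using dist unfolding distribution_def by (metis subspace_span)

lemma E_tangent: "v \<in> E p \<Longrightarrow> v \<in> tangent_space A p"
proof -
  obtain W F where W: "p \<in> W" "\<And>i. i < r \<Longrightarrow> smooth_vfield_on A W (F i)"
    "span ((\<lambda>i. F i p) ` {..<r}) = E p"
    using dist unfolding distribution_def by metis
  have "span ((\<lambda>i. F i p) ` {..<r}) \<subseteq> tangent_space A p"
    using W(1,2) by (intro span_minimal[OF _ subspace_tangent_space]) (auto simp: smooth_vfield_on_def)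
  then show "v \<in> E p \<Longrightarrow> ?thesis" using W(3) by auto
qed

lemma sections_vfields: "X \<in> sections A E \<Longrightarrow> X \<in> vfields A"
  and sections_mem: "X \<in> sections A E \<Longrightarrow> X p \<in> E p"
  by (auto simp: sections_def)

lemma sections_scale: "f \<in> C_inf A \<Longrightarrow> X \<in> sections A E \<Longrightarrow> (\<lambda>p. f p *\<^sub>R X p) \<in> sections A E"
  by (simp add: sections_def vfields_scale subspace_scale[OF subspace_E])

lemma sections_add: "X \<in> sections A E \<Longrightarrow> Y \<in> sections A E \<Longrightarrow> X + Y \<in> sections A E"
  by (simp add: sections_def vfields_add subspace_add[OF subspace_E])

lemma sections_sum: "(\<And>i. i \<in> I \<Longrightarrow> X i \<in> sections A E) \<Longrightarrow> (\<lambda>p. \<Sum>i\<in>I. X i p) \<in> sections A E"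
  by (simp add: sections_def vfields_sum subspace_sum[OF subspace_E])

text \<open>The local frame of \<open>E\<close> is multiplied by a bump function \<open>b\<close> to get global fields, which
  are still a frame wherever \<open>b\<close> is nonzero; these are orthogonalized.\<close>

lemma orthogonal_frame:
  obtains G b where "\<And>i. i < r \<Longrightarrow> G i \<in> sections A E" "b \<in> C_inf A" "b p \<noteq> 0"
    "\<And>i j q. i < r \<Longrightarrow> j < r \<Longrightarrow> i \<noteq> j \<Longrightarrow> g q (G i q) (G j q) = 0"
    "\<And>i q. b q \<noteq> 0 \<Longrightarrow> i < r \<Longrightarrow> G i q \<noteq> 0"
    "\<And>q. b q \<noteq> 0 \<Longrightarrow> span ((\<lambda>i. G i q) ` {..<r}) = E q"
proof -
  obtain W F where W: "open W" "p \<in> W" and F: "\<And>i. i < r \<Longrightarrow> smooth_vfield_on A W (F i)"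
    and inj: "\<And>q. q \<in> W \<Longrightarrow> inj_on (\<lambda>i. F i q) {..<r}"
    and ind: "\<And>q. q \<in> W \<Longrightarrow> independent ((\<lambda>i. F i q) ` {..<r})"
    and sp: "\<And>q. q \<in> W \<Longrightarrow> span ((\<lambda>i. F i q) ` {..<r}) = E q"
    using dist unfolding distribution_def by metis
  obtain b where b: "bump_in W b" "b p \<noteq> 0" using bump_exists[OF W] .
  define F' where "F' i q = b q *\<^sub>R (if q \<in> W then F i q else 0)" for i q
  have F'V: "F' i \<in> vfields A" if "i < r" for i
    unfolding F'_def[abs_def] by (rule vfields_bump_extend[OF W(1) b(1) F[OF that]])
  have bW: "q \<in> W" if "b q \<noteq> 0" for q using bump_inD(2)[OF b(1)] that by blast
  have sp': "span ((\<lambda>i. F' i q) ` {..<k}) = span ((\<lambda>i. F i q) ` {..<k})" if "b q \<noteq> 0" for q k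
    unfolding F'_def using bW[OF that] span_image_scaleR[OF that] by simp
  define S where "S = {q. b q \<noteq> 0}"
  \<comment> \<open>Pointwise rescaling by b preserves independence, here in the triangular form that Gram-Schmidt uses.\<close>
  have nin: "F' k q \<notin> span ((\<lambda>j. F' j q) ` {..<k})" if q: "q \<in> S" and k: "k < r" for q k
  proof
    have q: "b q \<noteq> 0" "q \<in> W" using q bW by (auto simp: S_def)
    assume "F' k q \<in> span ((\<lambda>j. F' j q) ` {..<k})"
    then have "inverse (b q) *\<^sub>R F' k q \<in> span ((\<lambda>j. F j q) ` {..<k})"
      unfolding sp'[OF q(1)] by (rule span_scale)
    then have "F k q \<in> span ((\<lambda>j. F j q) ` {..<k})" using q by (simp add: F'_def)
    moreover have "(\<lambda>j. F j q) ` {..<k} \<subseteq> (\<lambda>j. F j q) ` {..<r} - {F k q}"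
      using k inj_onD[OF inj[OF q(2)]] by fastforce
    ultimately have "dependent ((\<lambda>j. F j q) ` {..<r})"
      using k span_mono unfolding dependent_def by blast
    then show False using ind[OF q(2)] by simp
  qed
  have F'E: "span ((\<lambda>j. F' j q) ` {..<r}) \<subseteq> E q" for q
  proof (rule span_minimal[OF _ subspace_E])
    have "F' j q \<in> E q" if "j < r" for j
      using sp[of q] that subspace_0[OF subspace_E] span_base[of "F j q" "(\<lambda>i. F i q) ` {..<r}"]
      by (auto simp: F'_def intro!: subspace_scale[OF subspace_E])
    then show "(\<lambda>j. F' j q) ` {..<r} \<subseteq> E q" by auto
  qed
  obtain G where G: "\<And>i. i < r \<Longrightarrow> G i \<in> vfields A"
    "\<And>i j q. i < r \<Longrightarrow> j < r \<Longrightarrow> i \<noteq> j \<Longrightarrow> g q (G i q) (G j q) = 0"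
    "\<And>i q. i < r \<Longrightarrow> G i q \<in> span ((\<lambda>j. F' j q) ` {..<r})"
    "\<And>i q. q \<in> S \<Longrightarrow> i < r \<Longrightarrow> G i q \<noteq> 0"
    "\<And>q. q \<in> S \<Longrightarrow> span ((\<lambda>j. G j q) ` {..<r}) = span ((\<lambda>j. F' j q) ` {..<r})"
    by (rule gram_schmidt[where W = S, OF F'V nin], assumption, assumption, assumption, rule that)
  show ?thesis
  proof (rule that[of G b])
    show "G i \<in> sections A E" if "i < r" for i
      using G(1,3)[OF that] F'E by (auto simp: sections_def)
    show "span ((\<lambda>j. G j q) ` {..<r}) = E q" if "b q \<noteq> 0" for q
      using G(5)[of q] that sp'[OF that] sp[OF bW[OF that]] by (simp add: S_def)
  qed (use b bump_inD(1) G in \<open>auto simp: S_def\<close>)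
qed

lemma section_through:
  assumes "w \<in> E p"
  shows "\<exists>Y\<in>sections A E. Y p = w"
proof -
  obtain G b where G: "\<And>i. i < r \<Longrightarrow> G i \<in> sections A E" "b \<in> C_inf A" "b p \<noteq> 0"
    "\<And>i j q. i < r \<Longrightarrow> j < r \<Longrightarrow> i \<noteq> j \<Longrightarrow> g q (G i q) (G j q) = 0"
    "\<And>i q. b q \<noteq> 0 \<Longrightarrow> i < r \<Longrightarrow> G i q \<noteq> 0"
    "\<And>q. b q \<noteq> 0 \<Longrightarrow> span ((\<lambda>i. G i q) ` {..<r}) = E q"
    using orthogonal_frame[of p] by metis
  define c where "c i = g p w (G i p) / g p (G i p) (G i p)" for i
  have "w = (\<Sum>i<r. c i *\<^sub>R G i p)"
    unfolding c_def
    by (rule orthogonal_expansion) (use G assms E_tangent[OF sections_mem] in auto)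
  then show ?thesis
    by (intro bexI[of _ "\<lambda>q. \<Sum>i<r. c i *\<^sub>R G i q"] sections_sum sections_scale C_inf_const G) auto
qed

lemma section_eqI:
  assumes "v \<in> E p" "w \<in> E p" "\<And>X. X \<in> sections A E \<Longrightarrow> g p v (X p) = g p w (X p)"
  shows "v = w"
proof -
  obtain X where X: "X \<in> sections A E" "X p = v - w"
    using section_through[OF subspace_diff[OF subspace_E assms(1,2)]] by blast
  have T: "v \<in> tangent_space A p" "w \<in> tangent_space A p" "v - w \<in> tangent_space A p"
    using assms(1,2) E_tangent subspace_diff[OF subspace_E] by auto
  have "g p (v - w) (v - w) = 0"
    using assms(3)[OF X(1)] X(2) by (simp add: g_diff_left T)
  then show ?thesis using g_eq_0_iff[OF T(3)] by simp
qed

text \<open>In an orthogonal frame \<open>G\<close> the representing section must be \<open>\<Sum>i. \<alpha>(G i) / g(G i, G i) G i\<close>.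
  To evaluate \<open>\<alpha>\<close> on an arbitrary section \<open>X\<close>, the expansion of \<open>X\<close> in the frame is multiplied by
  \<open>b \<Prod>i. g(G i, G i)\<close>: it then holds globally with globally smooth coefficients, and \<open>\<alpha>\<close> passes
  through it. This step also shows that \<open>\<alpha>\<close> is local. The local solutions agree
  pointwise by \<open>section_eqI\<close>, so they define one smooth section.\<close>

lemma riesz_representation:
  assumes \<alpha>C: "\<And>X. X \<in> sections A E \<Longrightarrow> \<alpha> X \<in> C_inf A"
    and \<alpha>_add: "\<And>X Y p. X \<in> sections A E \<Longrightarrow> Y \<in> sections A E \<Longrightarrow> \<alpha> (X + Y) p = \<alpha> X p + \<alpha> Y p"
    and \<alpha>_scale: "\<And>f X p. f \<in> C_inf A \<Longrightarrow> X \<in> sections A E \<Longrightarrow> \<alpha> (\<lambda>q. f q *\<^sub>R X q) p = f p * \<alpha> X p"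
  shows "\<exists>V\<in>sections A E. \<forall>X\<in>sections A E. \<forall>p. g p (V p) (X p) = \<alpha> X p"
proof -
  have \<alpha>_0: "\<alpha> (\<lambda>q. 0) p = 0" if "X \<in> sections A E" for X p
    using \<alpha>_scale[OF C_inf_const[of 0] that] by simp
  have \<alpha>_sum: "\<alpha> (\<lambda>q. \<Sum>i<k. X i q) p = (\<Sum>i<k. \<alpha> (X i) p)"
    if "\<And>i. i < k \<Longrightarrow> X i \<in> sections A E" for X p and k :: nat
    using that
  proof (induction k)
    case 0
    have "(\<lambda>q. \<Sum>i\<in>{}. X i q) \<in> sections A E" by (rule sections_sum) simp
    from \<alpha>_0[OF this] show ?case by (simp add: zero_fun_def)
  next
    case (Suc k)
    then have "(\<lambda>q. \<Sum>i<k. X i q) \<in> sections A E" "X k \<in> sections A E" by (auto intro!: sections_sum)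
    from \<alpha>_add[OF this] show ?case using Suc by (simp add: plus_fun_def)
  qed
  let ?rep = "\<lambda>p v. v \<in> E p \<and> (\<forall>X\<in>sections A E. g p v (X p) = \<alpha> X p)"
  have loc: "\<exists>B V. open B \<and> p \<in> B \<and> (\<forall>q\<in>B. ?rep q (V q)) \<and> (\<forall>f\<in>C_inf A. smooth_fun_on A B (\<lambda>q. V q f))" for p
  proof -
    obtain G b where G: "\<And>i. i < r \<Longrightarrow> G i \<in> sections A E" and b: "b \<in> C_inf A" "b p \<noteq> 0"
      and orth: "\<And>i j q. i < r \<Longrightarrow> j < r \<Longrightarrow> i \<noteq> j \<Longrightarrow> g q (G i q) (G j q) = 0"
      and G0: "\<And>i q. b q \<noteq> 0 \<Longrightarrow> i < r \<Longrightarrow> G i q \<noteq> 0"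
      and sp: "\<And>q. b q \<noteq> 0 \<Longrightarrow> span ((\<lambda>i. G i q) ` {..<r}) = E q"
      using orthogonal_frame[of p] by metis
    note GV = sections_vfields[OF G]
    define n where "n i q = g q (G i q) (G i q)" for i q
    define V where "V q = (\<Sum>i<r. (\<alpha> (G i) q * inverse (n i q)) *\<^sub>R G i q)" for q
    have nC: "n i \<in> C_inf A" if "i < r" for i
      using g_C_inf[OF GV[OF that] GV[OF that]] by (simp add: n_def[abs_def])
    have n0: "n i q \<noteq> 0" if "b q \<noteq> 0" "i < r" for i q
      using G0[OF that] GV[OF that(2)] by (simp add: n_def g_eq_0_iff)
    have "?rep q (V q)" if q: "b q \<noteq> 0" for q
    proof (intro conjI ballI)
      show "V q \<in> E q" unfolding V_def
        by (intro subspace_sum[OF subspace_E] subspace_scale[OF subspace_E] sections_mem G) auto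
      fix X assume X: "X \<in> sections A E"
      note XV = sections_vfields[OF X]
      define N where "N q = (\<Prod>i<r. n i q)" for q
      define c where "c j q = b q * (\<Prod>i\<in>{..<r} - {j}. n i q) * g q (X q) (G j q)" for j q
      have cC: "c j \<in> C_inf A" if "j < r" for j
        unfolding c_def[abs_def] using nC by (intro C_inf_mult C_inf_prod g_C_inf b XV GV that) auto
      have NC: "(\<lambda>q. b q * N q) \<in> C_inf A"
        unfolding N_def by (intro C_inf_mult C_inf_prod b nC) auto
      have c_eq: "c j q = b q * N q * (g q (X q) (G j q) / n j q)" if "j < r" "b q \<noteq> 0" for j q
        using that n0[OF that(2,1)] prod.remove[of "{..<r}" j "\<lambda>i. n i q"] by (simp add: c_def N_def)
      \<comment> \<open>The expansion of X, multiplied by a function that vanishes off the domain of the frame.\<close>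
      have XG: "(b q * N q) *\<^sub>R X q = (\<Sum>i<r. c i q *\<^sub>R G i q)" for q
      proof (cases "b q = 0")
        case False
        have "X q = (\<Sum>i<r. (g q (X q) (G i q) / g q (G i q) (G i q)) *\<^sub>R G i q)"
          by (rule orthogonal_expansion)
             (use False GV orth G0 sp sections_mem[OF X] in auto)
        then have "(b q * N q) *\<^sub>R X q = (b q * N q) *\<^sub>R (\<Sum>i<r. (g q (X q) (G i q) / n i q) *\<^sub>R G i q)"
          by (simp add: n_def)
        also have "\<dots> = (\<Sum>i<r. c i q *\<^sub>R G i q)"
          unfolding scaleR_sum_right using c_eq False by (intro sum.cong) auto
        finally show ?thesis .
      qed (simp add: c_def)
      have "b q * N q * \<alpha> X q = \<alpha> (\<lambda>q. \<Sum>i<r. c i q *\<^sub>R G i q) q"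
        using \<alpha>_scale[OF NC X, of q] by (simp add: XG)
      also have "\<dots> = (\<Sum>i<r. c i q * \<alpha> (G i) q)"
        using \<alpha>_sum[of r "\<lambda>i q. c i q *\<^sub>R G i q" q] by (simp add: sections_scale cC G \<alpha>_scale)
      also have "\<dots> = b q * N q * (\<Sum>i<r. \<alpha> (G i) q * inverse (n i q) * g q (G i q) (X q))"
        unfolding sum_distrib_left
        by (intro sum.cong) (auto simp: c_eq q g_sym[OF vfields_tangent[OF XV] vfields_tangent[OF GV]] field_simps)
      also have "(\<Sum>i<r. \<alpha> (G i) q * inverse (n i q) * g q (G i q) (X q)) = g q (V q) (X q)"
        unfolding V_def
        by (subst g_sum_left) (auto simp: GV XV g_scale_left subspace_scale[OF subspace_tangent_space])
      finally have "b q * N q * \<alpha> X q = b q * N q * g q (V q) (X q)" .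
      moreover have "N q \<noteq> 0" using n0[OF q] by (simp add: N_def)
      ultimately show "g q (V q) (X q) = \<alpha> X q" using q by simp
    qed
    moreover have "smooth_fun_on A {q. b q \<noteq> 0} (\<lambda>q. V q f)" for f
      unfolding V_def sum_fun_apply scaleR_fun_apply real_scaleR_def
      by (intro smooth_fun_on_sum smooth_fun_on_mult smooth_fun_on_inverse C_inf_open_support[OF b(1)]
          C_inf_imp_smooth_fun_on \<alpha>C G nC vfields_C_inf GV) (use n0 in auto)
    ultimately show ?thesis
      using C_inf_open_support[OF b(1)] b(2) by (intro exI[of _ "{q. b q \<noteq> 0}"] exI[of _ V]) auto
  qed
  define V where "V p = (SOME v. ?rep p v)" for p
  have V: "?rep p (V p)" for p
  proof -
    obtain v where "?rep p v" using loc[of p] by blast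
    then show ?thesis unfolding V_def by (rule someI[of "?rep p"])
  qed
  have V_eq: "V q = v" if "?rep q v" for q v
    using V[of q] that by (intro section_eqI) auto
  have "V \<in> vfields A"
  proof (rule vfieldsI)
    show "V p \<in> tangent_space A p" for p using V E_tangent by blast
    fix f assume f: "f \<in> C_inf A"
    show "(\<lambda>p. V p f) \<in> C_inf A"
      unfolding C_inf_def mem_Collect_eq
    proof (rule smooth_fun_on_locally)
      fix p
      obtain B V' where B: "open B" "p \<in> B" "\<forall>q\<in>B. ?rep q (V' q)" "smooth_fun_on A B (\<lambda>q. V' q f)"
        using loc[of p] f by blast
      have "smooth_fun_on A B (\<lambda>q. V q f)"
        by (rule smooth_fun_on_cong[OF B(1) _ B(4)]) (use B(3) V_eq in metis)
      then show "\<exists>W. open W \<and> p \<in> W \<and> smooth_fun_on A W (\<lambda>q. V q f)" using B by blast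
    qed
  qed
  then show ?thesis using V by (intro bexI[of _ V]) (auto simp: sections_def)
qed

end

section \<open>The Leibniz rules for the Lie bracket and the metric\<close>

lemma lie_bracket_antisym: "lie_bracket Y X p = - lie_bracket X Y p"
  by (simp add: lie_bracket_def fun_eq_iff)

context smooth_manifold
begin

lemma lie_bracket_add_left:
  assumes "X \<in> vfields A" "Y \<in> vfields A" "Z \<in> vfields A"
  shows "lie_bracket (X + Y) Z p = lie_bracket X Z p + lie_bracket Y Z p"
  by (rule ext)
     (simp add: lie_bracket_def tangent_add[OF vfields_tangent[OF assms(3)] vfields_C_inf[OF assms(1)] vfields_C_inf[OF assms(2)]])

lemma lie_bracket_add_right:
  assumes "X \<in> vfields A" "Y \<in> vfields A" "Z \<in> vfields A"
  shows "lie_bracket Z (X + Y) p = lie_bracket Z X p + lie_bracket Z Y p"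
  by (rule ext)
     (simp add: lie_bracket_def tangent_add[OF vfields_tangent[OF assms(3)] vfields_C_inf[OF assms(1)] vfields_C_inf[OF assms(2)]])

lemma lie_bracket_scale_right:
  assumes f: "f \<in> C_inf A" and X: "X \<in> vfields A" and Y: "Y \<in> vfields A"
  shows "lie_bracket X (\<lambda>q. f q *\<^sub>R Y q) p = f p *\<^sub>R lie_bracket X Y p + X p f *\<^sub>R Y p"
  by (rule ext)
     (simp add: lie_bracket_def tangent_mult[OF vfields_tangent[OF X] f vfields_C_inf[OF Y]] algebra_simps)

lemma lie_bracket_scale_left:
  assumes f: "f \<in> C_inf A" and X: "X \<in> vfields A" and Y: "Y \<in> vfields A"
  shows "lie_bracket (\<lambda>q. f q *\<^sub>R X q) Y p = f p *\<^sub>R lie_bracket X Y p - Y p f *\<^sub>R X p"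
  using lie_bracket_scale_right[OF f Y X, of p] lie_bracket_antisym[of _ Y p] by simp

end

context riemannian_manifold
begin

abbreviation ip :: "'a vfield \<Rightarrow> 'a vfield \<Rightarrow> 'a \<Rightarrow> real" where
  "ip X Y \<equiv> (\<lambda>p. g p (X p) (Y p))"

lemma ip_sym: "X \<in> vfields A \<Longrightarrow> Y \<in> vfields A \<Longrightarrow> ip X Y = ip Y X"
  by (simp add: fun_eq_iff g_sym)

lemmas tangent_closed = subspace_scale[OF subspace_tangent_space] subspace_add[OF subspace_tangent_space]
  subspace_diff[OF subspace_tangent_space]

lemma deriv_ip_add_left:
  assumes "v \<in> tangent_space A p" "X \<in> vfields A" "Y \<in> vfields A" "Z \<in> vfields A"
  shows "v (ip (X + Y) Z) = v (ip X Z) + v (ip Y Z)"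
  using tangent_add[OF assms(1) g_C_inf[OF assms(2,4)] g_C_inf[OF assms(3,4)]] assms
  by (simp add: g_add_left)

lemma deriv_ip_add_right:
  assumes "v \<in> tangent_space A p" "X \<in> vfields A" "Y \<in> vfields A" "Z \<in> vfields A"
  shows "v (ip Z (X + Y)) = v (ip Z X) + v (ip Z Y)"
  using tangent_add[OF assms(1) g_C_inf[OF assms(4,2)] g_C_inf[OF assms(4,3)]] assms
  by (simp add: g_add_right)

lemma deriv_ip_scale_left:
  assumes "v \<in> tangent_space A p" "f \<in> C_inf A" "X \<in> vfields A" "Z \<in> vfields A"
  shows "v (ip (\<lambda>q. f q *\<^sub>R X q) Z) = f p * v (ip X Z) + v f * ip X Z p"
  using tangent_mult[OF assms(1,2) g_C_inf[OF assms(3,4)]] assms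
  by (simp add: g_scale_left mult.commute)

lemma deriv_ip_scale_right:
  assumes "v \<in> tangent_space A p" "f \<in> C_inf A" "X \<in> vfields A" "Z \<in> vfields A"
  shows "v (ip Z (\<lambda>q. f q *\<^sub>R X q)) = f p * v (ip Z X) + v f * ip Z X p"
  using tangent_mult[OF assms(1,2) g_C_inf[OF assms(4,3)]] assms
  by (simp add: g_scale_right mult.commute)

lemma vfield_eqI:
  assumes "V \<in> vfields A" "W \<in> vfields A" "\<And>Z p. Z \<in> vfields A \<Longrightarrow> g p (V p) (Z p) = g p (W p) (Z p)"
  shows "V = W"
proof
  fix p
  have "g p (V p - W p) (V p - W p) = 0"
    using assms(3)[OF vfields_diff[OF assms(1,2)], of p] assms(1,2) by (simp add: g_diff_left tangent_closed)
  then show "V p = W p" using assms(1,2) by (simp add: g_eq_0_iff tangent_closed)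
qed

lemma metric_dual:
  assumes "\<And>X. X \<in> vfields A \<Longrightarrow> \<alpha> X \<in> C_inf A"
    and "\<And>X Y p. X \<in> vfields A \<Longrightarrow> Y \<in> vfields A \<Longrightarrow> \<alpha> (X + Y) p = \<alpha> X p + \<alpha> Y p"
    and "\<And>f X p. f \<in> C_inf A \<Longrightarrow> X \<in> vfields A \<Longrightarrow> \<alpha> (\<lambda>q. f q *\<^sub>R X q) p = f p * \<alpha> X p"
  shows "\<exists>V\<in>vfields A. \<forall>X\<in>vfields A. \<forall>p. g p (V p) (X p) = \<alpha> X p"
proof -
  interpret TM: riemannian_distribution A g "tangent_space A" "DIM('e)"
    by unfold_locales (rule distribution_tangent_space)
  have "sections A (tangent_space A) = vfields A" by (auto simp: sections_def)
  then show ?thesis using TM.riesz_representation[of \<alpha>] assms by simp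
qed

section \<open>Tensoriality of the Lie derivative of the metric\<close>

lemma lie_derivative_C_inf:
  "X \<in> vfields A \<Longrightarrow> Y \<in> vfields A \<Longrightarrow> Z \<in> vfields A \<Longrightarrow> lie_derivative X g Y Z \<in> C_inf A"
  unfolding lie_derivative_def[abs_def]
  by (intro C_inf_diff vfields_C_inf g_C_inf lie_bracket_vfields)

lemma lie_derivative_sym:
  "X \<in> vfields A \<Longrightarrow> Y \<in> vfields A \<Longrightarrow> Z \<in> vfields A \<Longrightarrow> lie_derivative X g Y Z p = lie_derivative X g Z Y p"
  unfolding lie_derivative_def
  by (subst ip_sym) (simp_all add: g_sym[of "lie_bracket _ _ p"] lie_bracket_vfields)

lemma lie_derivative_add_direction:
  assumes "X \<in> vfields A" "X' \<in> vfields A" "Y \<in> vfields A" "Z \<in> vfields A"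
  shows "lie_derivative (X + X') g Y Z p = lie_derivative X g Y Z p + lie_derivative X' g Y Z p"
  using assms
  by (simp add: lie_derivative_def lie_bracket_add_left g_add_left g_add_right lie_bracket_vfields)

text \<open>In general the left-hand side has the additional terms \<open>(Y f) g(X, Z) + (Z f) g(Y, X)\<close>.
  Conditions (2) and (3) of the theorem use the Lie derivative only for arguments on which they vanish.\<close>

lemma lie_derivative_scale_direction:
  assumes "f \<in> C_inf A" "X \<in> vfields A" "Y \<in> vfields A" "Z \<in> vfields A"
    and "ip X Y p = 0" "ip X Z p = 0"
  shows "lie_derivative (\<lambda>q. f q *\<^sub>R X q) g Y Z p = f p * lie_derivative X g Y Z p"
  using assms g_sym[of "Y p" p "X p"]
  by (simp add: lie_derivative_def lie_bracket_scale_left g_diff_left g_diff_right g_scale_left g_scale_right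
      lie_bracket_vfields tangent_closed algebra_simps)

lemma lie_derivative_add:
  assumes "X \<in> vfields A" "Y \<in> vfields A" "Y' \<in> vfields A" "Z \<in> vfields A"
  shows "lie_derivative X g (Y + Y') Z p = lie_derivative X g Y Z p + lie_derivative X g Y' Z p"
  unfolding lie_derivative_def
  by (subst deriv_ip_add_left[of _ p])
     (use assms in \<open>simp_all add: lie_bracket_add_right g_add_left lie_bracket_vfields\<close>)

lemma lie_derivative_scale:
  assumes "f \<in> C_inf A" "X \<in> vfields A" "Y \<in> vfields A" "Z \<in> vfields A"
  shows "lie_derivative X g (\<lambda>q. f q *\<^sub>R Y q) Z p = f p * lie_derivative X g Y Z p"
  unfolding lie_derivative_def
  by (subst deriv_ip_scale_left[of _ p])
     (use assms in \<open>simp_all add: lie_bracket_scale_right g_add_left g_scale_left lie_bracket_vfields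
       tangent_closed algebra_simps\<close>)

section \<open>Metric connections with prescribed torsion\<close>

definition tensorial3 :: "('a vfield \<Rightarrow> 'a vfield \<Rightarrow> 'a vfield \<Rightarrow> 'a \<Rightarrow> real) \<Rightarrow> bool" where
  "tensorial3 t \<longleftrightarrow>
     (\<forall>X\<in>vfields A. \<forall>Y\<in>vfields A. \<forall>Z\<in>vfields A. t X Y Z \<in> C_inf A \<and>
        (\<forall>W\<in>vfields A. \<forall>p. t (X + W) Y Z p = t X Y Z p + t W Y Z p \<and>
           t X (Y + W) Z p = t X Y Z p + t X W Z p \<and> t X Y (Z + W) p = t X Y Z p + t X Y W p) \<and>
        (\<forall>f\<in>C_inf A. \<forall>p. t (\<lambda>q. f q *\<^sub>R X q) Y Z p = f p * t X Y Z p \<and>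
           t X (\<lambda>q. f q *\<^sub>R Y q) Z p = f p * t X Y Z p \<and> t X Y (\<lambda>q. f q *\<^sub>R Z q) p = f p * t X Y Z p))"

context
  fixes t
  assumes t: "tensorial3 t"
    and t_skew: "\<And>X Y Z p. X \<in> vfields A \<Longrightarrow> Y \<in> vfields A \<Longrightarrow> Z \<in> vfields A \<Longrightarrow> t Y X Z p = - t X Y Z p"
begin

lemma t_C_inf: "X \<in> vfields A \<Longrightarrow> Y \<in> vfields A \<Longrightarrow> Z \<in> vfields A \<Longrightarrow> t X Y Z \<in> C_inf A"
  and t_add: "X \<in> vfields A \<Longrightarrow> Y \<in> vfields A \<Longrightarrow> Z \<in> vfields A \<Longrightarrow> W \<in> vfields A \<Longrightarrow> t (X + W) Y Z p = t X Y Z p + t W Y Z p"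
    "X \<in> vfields A \<Longrightarrow> Y \<in> vfields A \<Longrightarrow> Z \<in> vfields A \<Longrightarrow> W \<in> vfields A \<Longrightarrow> t X (Y + W) Z p = t X Y Z p + t X W Z p"
    "X \<in> vfields A \<Longrightarrow> Y \<in> vfields A \<Longrightarrow> Z \<in> vfields A \<Longrightarrow> W \<in> vfields A \<Longrightarrow> t X Y (Z + W) p = t X Y Z p + t X Y W p"
  and t_scale: "X \<in> vfields A \<Longrightarrow> Y \<in> vfields A \<Longrightarrow> Z \<in> vfields A \<Longrightarrow> f \<in> C_inf A \<Longrightarrow> t (\<lambda>q. f q *\<^sub>R X q) Y Z p = f p * t X Y Z p"
    "X \<in> vfields A \<Longrightarrow> Y \<in> vfields A \<Longrightarrow> Z \<in> vfields A \<Longrightarrow> f \<in> C_inf A \<Longrightarrow> t X (\<lambda>q. f q *\<^sub>R Y q) Z p = f p * t X Y Z p"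
    "X \<in> vfields A \<Longrightarrow> Y \<in> vfields A \<Longrightarrow> Z \<in> vfields A \<Longrightarrow> f \<in> C_inf A \<Longrightarrow> t X Y (\<lambda>q. f q *\<^sub>R Z q) p = f p * t X Y Z p"
  using t unfolding tensorial3_def by blast+

text \<open>The classical formula with \<open>g([U, V], W)\<close> replaced by \<open>g([U, V], W) + t(U, V, W)\<close> in all three
  places.\<close>

definition koszul :: "'a vfield \<Rightarrow> 'a vfield \<Rightarrow> 'a vfield \<Rightarrow> 'a \<Rightarrow> real" where
  "koszul X Y Z p = 1/2 * (X p (ip Y Z) + Y p (ip X Z) - Z p (ip X Y)
     + (g p (lie_bracket X Y p) (Z p) + t X Y Z p)
     - (g p (lie_bracket X Z p) (Y p) + t X Z Y p)
     - (g p (lie_bracket Y Z p) (X p) + t Y Z X p))"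

lemma koszul_C_inf:
  assumes V: "X \<in> vfields A" "Y \<in> vfields A" "Z \<in> vfields A"
  shows "koszul X Y Z \<in> C_inf A"
  unfolding koszul_def[abs_def]
  by (intro C_inf_const C_inf_mult C_inf_diff C_inf_add V(1)[THEN vfields_C_inf] V(2)[THEN vfields_C_inf]
      V(3)[THEN vfields_C_inf] g_C_inf V lie_bracket_vfields t_C_inf)

lemma koszul_add:
  assumes V: "X \<in> vfields A" "Y \<in> vfields A" "Z \<in> vfields A" "W \<in> vfields A"
  shows "koszul (X + W) Y Z p = koszul X Y Z p + koszul W Y Z p"
    "koszul X (Y + W) Z p = koszul X Y Z p + koszul X W Z p"
    "koszul X Y (Z + W) p = koszul X Y Z p + koszul X Y W p"
proof -
  note d = deriv_ip_add_left[OF vfields_tangent, of _ _ _ _ p] deriv_ip_add_right[OF vfields_tangent, of _ _ _ _ p]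
  note s = lie_bracket_add_left lie_bracket_add_right g_add_left g_add_right lie_bracket_vfields t_add
  show "koszul (X + W) Y Z p = koszul X Y Z p + koszul W Y Z p"
    "koszul X (Y + W) Z p = koszul X Y Z p + koszul X W Z p"
    "koszul X Y (Z + W) p = koszul X Y Z p + koszul X Y W p"
    unfolding koszul_def
      d(1)[OF V(2) V(1,4,3)] d(1)[OF V(3) V(1,4,2)]
      d(1)[OF V(1) V(2,4,3)] d(2)[OF V(3) V(2,4,1)]
      d(2)[OF V(1) V(3,4,2)] d(2)[OF V(2) V(3,4,1)]
    using V by (simp_all add: s field_simps)
qed

text \<open>The derivatives of \<open>f\<close> produced by the first three terms and by the brackets cancel, except in the
  second argument, where two of them add up to the Leibniz term of a connection.\<close>

lemma koszul_scale:
  assumes f: "f \<in> C_inf A" and V: "X \<in> vfields A" "Y \<in> vfields A" "Z \<in> vfields A"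
  shows "koszul (\<lambda>q. f q *\<^sub>R X q) Y Z p = f p * koszul X Y Z p"
    "koszul X (\<lambda>q. f q *\<^sub>R Y q) Z p = X p f * ip Y Z p + f p * koszul X Y Z p"
    "koszul X Y (\<lambda>q. f q *\<^sub>R Z q) p = f p * koszul X Y Z p"
proof -
  note d = deriv_ip_scale_left[OF vfields_tangent f, of _ _ _ p] deriv_ip_scale_right[OF vfields_tangent f, of _ _ _ p]
  note s = lie_bracket_scale_left lie_bracket_scale_right g_add_left g_diff_left g_scale_left g_scale_right
    lie_bracket_vfields t_scale tangent_closed
  have sym: "g p (Y p) (X p) = g p (X p) (Y p)" "g p (Z p) (X p) = g p (X p) (Z p)" "g p (Z p) (Y p) = g p (Y p) (Z p)"
    using V by (simp_all add: g_sym)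
  show "koszul (\<lambda>q. f q *\<^sub>R X q) Y Z p = f p * koszul X Y Z p"
    "koszul X (\<lambda>q. f q *\<^sub>R Y q) Z p = X p f * ip Y Z p + f p * koszul X Y Z p"
    "koszul X Y (\<lambda>q. f q *\<^sub>R Z q) p = f p * koszul X Y Z p"
    unfolding koszul_def
      d(1)[OF V(2) V(1,3)] d(1)[OF V(3) V(1,2)]
      d(1)[OF V(1) V(2,3)] d(2)[OF V(3) V(2,1)]
      d(2)[OF V(1) V(3,2)] d(2)[OF V(2) V(3,1)]
    using V f by (simp_all add: s sym field_simps)
qed

lemma torsion_apply: "torsion D X Y p = D X Y p - D Y X p - lie_bracket X Y p"
  by (simp add: torsion_def)

text \<open>Forwards, write each derivative of \<open>g\<close> by compatibility and each bracket term by the torsion: all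
  but one of the terms cancel. Backwards, compatibility is the part of the formula symmetric
  in \<open>Y, Z\<close>, and the torsion is the part skew in \<open>X, Y\<close>; both use the skewness of \<open>t\<close>.\<close>

lemma koszul_formula:
  assumes D: "\<And>X Y. X \<in> vfields A \<Longrightarrow> Y \<in> vfields A \<Longrightarrow> D X Y \<in> vfields A"
  shows "(metric_compatible A g D \<and>
      (\<forall>X\<in>vfields A. \<forall>Y\<in>vfields A. \<forall>Z\<in>vfields A. \<forall>p. g p (torsion D X Y p) (Z p) = t X Y Z p)) \<longleftrightarrow>
    (\<forall>X\<in>vfields A. \<forall>Y\<in>vfields A. \<forall>Z\<in>vfields A. \<forall>p. g p (D X Y p) (Z p) = koszul X Y Z p)"
    (is "?L \<longleftrightarrow> ?R")
proof -
  have tor: "g p (torsion D X Y p) (Z p) = g p (D X Y p) (Z p) - g p (D Y X p) (Z p) - g p (lie_bracket X Y p) (Z p)"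
    if "X \<in> vfields A" "Y \<in> vfields A" "Z \<in> vfields A" for X Y Z p
    using that by (simp add: torsion_apply g_diff_left D lie_bracket_vfields tangent_closed)
  have cov: "cov_derivative D X g Y Z p = X p (ip Y Z) - g p (D X Y p) (Z p) - g p (D X Z p) (Y p)"
    if "X \<in> vfields A" "Y \<in> vfields A" "Z \<in> vfields A" for X Y Z p
    using that by (simp add: cov_derivative_def g_sym D)
  show ?thesis
  proof
    assume L: ?L
    show ?R
    proof (intro ballI allI)
      fix X Y Z p assume V: "X \<in> vfields A" "Y \<in> vfields A" "Z \<in> vfields A"
      have M: "X p (ip Y Z) = g p (D X Y p) (Z p) + g p (D X Z p) (Y p)"
        if "X \<in> vfields A" "Y \<in> vfields A" "Z \<in> vfields A" for X Y Z
        using L cov[OF that, of p] that by (simp add: metric_compatible_def)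
      have T: "t X Y Z p = g p (D X Y p) (Z p) - g p (D Y X p) (Z p) - g p (lie_bracket X Y p) (Z p)"
        if "X \<in> vfields A" "Y \<in> vfields A" "Z \<in> vfields A" for X Y Z
        using L tor[OF that, of p] that by simp
      show "g p (D X Y p) (Z p) = koszul X Y Z p"
        unfolding koszul_def M[OF V] M[OF V(2,1,3)] M[OF V(3,1,2)] T[OF V] T[OF V(1,3,2)] T[OF V(2,3,1)]
        by (simp add: field_simps)
    qed
  next
    assume R: ?R
    have br: "g p (lie_bracket Y X p) (Z p) = - g p (lie_bracket X Y p) (Z p)"
      if "X \<in> vfields A" "Y \<in> vfields A" "Z \<in> vfields A" for X Y Z p
      using that g_scale_left[of "lie_bracket X Y p" p "Z p" "- 1"]
      by (simp add: lie_bracket_antisym[of Y X] lie_bracket_vfields)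
    show ?L
    proof (intro conjI ballI allI)
      show "metric_compatible A g D"
        unfolding metric_compatible_def
      proof (intro ballI allI)
        fix X Y Z p assume V: "X \<in> vfields A" "Y \<in> vfields A" "Z \<in> vfields A"
        have "koszul X Y Z p + koszul X Z Y p = X p (ip Y Z)"
          unfolding koszul_def
          using br[OF V(2,3,1), of p] t_skew[OF V(2,3,1), of p]
          by (simp add: ip_sym[OF V(3,2)] field_simps)
        then show "cov_derivative D X g Y Z p = 0" using R V by (simp add: cov)
      qed
    next
      fix X Y Z p assume V: "X \<in> vfields A" "Y \<in> vfields A" "Z \<in> vfields A"
      have "koszul X Y Z p - koszul Y X Z p = g p (lie_bracket X Y p) (Z p) + t X Y Z p"
        unfolding koszul_def
        using br[OF V, of p] t_skew[OF V, of p]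
        by (simp add: ip_sym[OF V(2,1)] field_simps)
      then show "g p (torsion D X Y p) (Z p) = t X Y Z p" using R V by (simp add: tor)
    qed
  qed
qed

lemma metric_connection_with_torsion:
  "\<exists>!D. affine_connection A D \<and> metric_compatible A g D \<and>
    (\<forall>X\<in>vfields A. \<forall>Y\<in>vfields A. \<forall>Z\<in>vfields A. \<forall>p. g p (torsion D X Y p) (Z p) = t X Y Z p)"
proof -
  have "\<exists>W. W \<in> vfields A \<and> (\<forall>Z\<in>vfields A. \<forall>p. g p (W p) (Z p) = koszul X Y Z p)"
    if "X \<in> vfields A" "Y \<in> vfields A" for X Y
    using metric_dual[of "koszul X Y"] koszul_C_inf koszul_add(3) koszul_scale(3) that by blast
  then obtain D0 where D0: "\<And>X Y. X \<in> vfields A \<Longrightarrow> Y \<in> vfields A \<Longrightarrow> D0 X Y \<in> vfields A"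
    "\<And>X Y Z p. X \<in> vfields A \<Longrightarrow> Y \<in> vfields A \<Longrightarrow> Z \<in> vfields A \<Longrightarrow> g p (D0 X Y p) (Z p) = koszul X Y Z p"
    by metis
  define D where "D = (\<lambda>X\<in>vfields A. \<lambda>Y\<in>vfields A. D0 X Y)"
  have D: "D X Y \<in> vfields A" "\<And>Z p. Z \<in> vfields A \<Longrightarrow> g p (D X Y p) (Z p) = koszul X Y Z p"
    if "X \<in> vfields A" "Y \<in> vfields A" for X Y
    using D0 that by (simp_all add: D_def)
  have aff: "affine_connection A D"
    unfolding affine_connection_def
  proof (intro conjI ballI)
    show "D \<in> vfields A \<rightarrow>\<^sub>E (vfields A \<rightarrow>\<^sub>E vfields A)" using D0(1) by (auto simp: D_def)
  next
    fix X Y Z assume V: "X \<in> vfields A" "Y \<in> vfields A" "Z \<in> vfields A"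
    show "D (X + Y) Z = D X Z + D Y Z"
      using V by (intro vfield_eqI) (simp_all add: D vfields_add g_add_left koszul_add)
    show "D X (Y + Z) = D X Y + D X Z"
      using V by (intro vfield_eqI) (simp_all add: D vfields_add g_add_left koszul_add)
  next
    fix X Y f assume V: "X \<in> vfields A" "Y \<in> vfields A" and f: "f \<in> C_inf A"
    show "D (\<lambda>p. f p *\<^sub>R X p) Y = (\<lambda>p. f p *\<^sub>R D X Y p)"
      using V f by (intro vfield_eqI) (simp_all add: D vfields_scale g_scale_left koszul_scale)
    have "(\<lambda>p. X p f *\<^sub>R Y p + f p *\<^sub>R D X Y p) \<in> vfields A"
      using vfields_add[OF vfields_scale[OF vfields_C_inf[OF V(1)] V(2)] vfields_scale[OF f D(1)[OF V]]]
      by (simp add: plus_fun_def)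
    then show "D X (\<lambda>p. f p *\<^sub>R Y p) = (\<lambda>p. X p f *\<^sub>R Y p + f p *\<^sub>R D X Y p)"
      using V f
      by (intro vfield_eqI) (simp_all add: D vfields_scale g_add_left g_scale_left koszul_scale tangent_closed)
  qed
  show ?thesis
  proof (rule ex1I[of _ D])
    show "affine_connection A D \<and> metric_compatible A g D \<and>
      (\<forall>X\<in>vfields A. \<forall>Y\<in>vfields A. \<forall>Z\<in>vfields A. \<forall>p. g p (torsion D X Y p) (Z p) = t X Y Z p)"
      using aff koszul_formula[of D] D by simp
  next
    fix D' assume D': "affine_connection A D' \<and> metric_compatible A g D' \<and>
      (\<forall>X\<in>vfields A. \<forall>Y\<in>vfields A. \<forall>Z\<in>vfields A. \<forall>p. g p (torsion D' X Y p) (Z p) = t X Y Z p)"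
    then have E: "D' \<in> vfields A \<rightarrow>\<^sub>E (vfields A \<rightarrow>\<^sub>E vfields A)" by (simp add: affine_connection_def)
    have V': "D' X Y \<in> vfields A" if "X \<in> vfields A" "Y \<in> vfields A" for X Y
      by (rule PiE_mem[OF PiE_mem[OF E that(1)] that(2)])
    have K: "g p (D' X Y p) (Z p) = koszul X Y Z p" if "X \<in> vfields A" "Y \<in> vfields A" "Z \<in> vfields A" for X Y Z p
      using koszul_formula[of D'] V' D' that by simp
    have eq: "D' X Y = D X Y" if "X \<in> vfields A" "Y \<in> vfields A" for X Y
      using that by (intro vfield_eqI) (simp_all add: V' D K)
    have ED: "D \<in> vfields A \<rightarrow>\<^sub>E (vfields A \<rightarrow>\<^sub>E vfields A)" using aff by (simp add: affine_connection_def)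
    show "D' = D"
    proof (rule PiE_ext[OF E ED])
      fix X assume X: "X \<in> vfields A"
      show "D' X = D X"
        by (rule PiE_ext[OF PiE_mem[OF E X] PiE_mem[OF ED X]]) (rule eq[OF X])
    qed
  qed
qed

end

end

section \<open>Horizontal and vertical parts of vector fields\<close>

context riemannian_distribution
begin

abbreviation E_perp where "E_perp \<equiv> orth_complement A g E"

lemma subspace_E_perp: "subspace (E_perp p)"
  unfolding subspace_def orth_complement_def
  using E_tangent by (auto simp: g_add_left g_scale_left tangent_closed)

lemma perp_vfields: "X \<in> sections A E_perp \<Longrightarrow> X \<in> vfields A"
  by (simp add: sections_def)

lemma perp_orthogonal:
  assumes "X \<in> sections A E" "\<xi> \<in> sections A E_perp"
  shows "ip \<xi> X p = 0" "ip X \<xi> p = 0"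
proof -
  show "ip \<xi> X p = 0" using assms by (simp add: sections_def orth_complement_def)
  then show "ip X \<xi> p = 0" using assms by (simp add: g_sym[of "X p"] sections_vfields perp_vfields)
qed

lemma perp_scale: "f \<in> C_inf A \<Longrightarrow> X \<in> sections A E_perp \<Longrightarrow> (\<lambda>p. f p *\<^sub>R X p) \<in> sections A E_perp"
  by (simp add: sections_def vfields_scale subspace_scale[OF subspace_E_perp])

lemma perp_add: "X \<in> sections A E_perp \<Longrightarrow> Y \<in> sections A E_perp \<Longrightarrow> X + Y \<in> sections A E_perp"
  by (simp add: sections_def vfields_add subspace_add[OF subspace_E_perp])

text \<open>The horizontal part represents the functional \<open>g(X, \<cdot>)\<close> on the sections of \<open>E\<close>.\<close>

lemma orthogonal_decomposition:
  assumes X: "X \<in> vfields A"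
  shows "\<exists>V. V \<in> sections A E \<and> X - V \<in> sections A E_perp"
proof -
  obtain V where V: "V \<in> sections A E" "\<And>Y p. Y \<in> sections A E \<Longrightarrow> g p (V p) (Y p) = g p (X p) (Y p)"
    using riesz_representation[of "ip X"] X
    by (auto simp: g_C_inf sections_vfields g_add_right g_scale_right)
  have "g p (X p - V p) w = 0" if w: "w \<in> E p" for p w
  proof -
    obtain Y where "Y \<in> sections A E" "Y p = w" using section_through[OF w] by blast
    then show ?thesis
      using V(2)[of Y p] X sections_vfields[OF V(1)] E_tangent[OF w] by (simp add: g_diff_left)
  qed
  then have "X - V \<in> sections A E_perp"
    using X sections_vfields[OF V(1)]
    by (simp add: sections_def orth_complement_def vfields_diff tangent_closed)
  then show ?thesis using V(1) by blast
qed

definition hor :: "'a vfield \<Rightarrow> 'a vfield" where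
  "hor X = (SOME V. V \<in> sections A E \<and> X - V \<in> sections A E_perp)"

definition ver :: "'a vfield \<Rightarrow> 'a vfield" where
  "ver X = X - hor X"

lemma hor_section: "X \<in> vfields A \<Longrightarrow> hor X \<in> sections A E"
  and ver_section: "X \<in> vfields A \<Longrightarrow> ver X \<in> sections A E_perp"
  using someI_ex[OF orthogonal_decomposition] by (simp_all add: hor_def ver_def)

lemma hor_plus_ver: "hor X + ver X = X"
  by (simp add: ver_def)

lemma hor_ver_unique:
  assumes V: "V \<in> sections A E" and U: "U \<in> sections A E_perp"
  shows "hor (V + U) = V" "ver (V + U) = U"
proof -
  let ?X = "V + U"
  have X: "?X \<in> vfields A" using V U by (simp add: vfields_add sections_vfields perp_vfields)
  note h = hor_section[OF X] and v = ver_section[OF X]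
  have "hor ?X p = V p" for p
  proof -
    let ?d = "hor ?X p - V p"
    have d: "?d = U p - ver ?X p" by (simp add: ver_def)
    have "?d \<in> E p" using subspace_diff[OF subspace_E] h V by (simp add: sections_def)
    moreover have "?d \<in> E_perp p" unfolding d using subspace_diff[OF subspace_E_perp] U v by (simp add: sections_def)
    ultimately have "g p ?d ?d = 0" "?d \<in> tangent_space A p" by (simp_all add: orth_complement_def)
    then have "?d = 0" by (simp only: g_eq_0_iff)
    then show ?thesis by simp
  qed
  then show "hor ?X = V" by (simp add: fun_eq_iff)
  then show "ver ?X = U" by (simp add: ver_def)
qed

lemma hor_ver_add:
  assumes "X \<in> vfields A" "Y \<in> vfields A"
  shows "hor (X + Y) = hor X + hor Y" "ver (X + Y) = ver X + ver Y"
proof -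
  have "X + Y = (hor X + hor Y) + (ver X + ver Y)" by (simp add: ver_def)
  then show "hor (X + Y) = hor X + hor Y" "ver (X + Y) = ver X + ver Y"
    using hor_ver_unique[OF sections_add[OF hor_section hor_section] perp_add[OF ver_section ver_section], OF assms assms]
    by simp_all
qed

lemma hor_ver_scale:
  assumes f: "f \<in> C_inf A" and X: "X \<in> vfields A"
  shows "hor (\<lambda>p. f p *\<^sub>R X p) = (\<lambda>p. f p *\<^sub>R hor X p)" "ver (\<lambda>p. f p *\<^sub>R X p) = (\<lambda>p. f p *\<^sub>R ver X p)"
proof -
  have "(\<lambda>p. f p *\<^sub>R X p) = (\<lambda>p. f p *\<^sub>R hor X p) + (\<lambda>p. f p *\<^sub>R ver X p)"
    by (simp add: ver_def fun_eq_iff algebra_simps)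
  then show "hor (\<lambda>p. f p *\<^sub>R X p) = (\<lambda>p. f p *\<^sub>R hor X p)" "ver (\<lambda>p. f p *\<^sub>R X p) = (\<lambda>p. f p *\<^sub>R ver X p)"
    using hor_ver_unique[OF sections_scale[OF f hor_section[OF X]] perp_scale[OF f ver_section[OF X]]] by simp_all
qed

lemma zero_sections: "0 \<in> sections A E" "0 \<in> sections A E_perp"
  by (simp_all add: sections_def vfields_0 subspace_0[OF subspace_E] subspace_0[OF subspace_E_perp])

lemma hor_ver_of_section: "X \<in> sections A E \<Longrightarrow> hor X = X" "X \<in> sections A E \<Longrightarrow> ver X = 0"
  using hor_ver_unique[of X 0] zero_sections by simp_all

lemma hor_ver_of_perp: "X \<in> sections A E_perp \<Longrightarrow> hor X = 0" "X \<in> sections A E_perp \<Longrightarrow> ver X = X"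
  using hor_ver_unique[of 0 X] zero_sections by simp_all

section \<open>The torsion prescribed by a distribution\<close>

text \<open>The value of \<open>g(\<tau>(\<xi>, X), Z)\<close> that conditions (2) and (3) impose for \<open>\<xi>\<close> orthogonal to \<open>E\<close>
  and \<open>X\<close> in \<open>E\<close>, obtained by splitting \<open>Z\<close>.\<close>

definition mixed_torsion :: "'a vfield \<Rightarrow> 'a vfield \<Rightarrow> 'a vfield \<Rightarrow> 'a \<Rightarrow> real" where
  "mixed_torsion \<xi> X Z p = 1/2 * lie_derivative \<xi> g X (hor Z) p - 1/2 * lie_derivative X g \<xi> (ver Z) p"

definition torsion_form :: "'a vfield \<Rightarrow> 'a vfield \<Rightarrow> 'a vfield \<Rightarrow> 'a \<Rightarrow> real" where
  "torsion_form X Y Z p = mixed_torsion (ver X) (hor Y) Z p - mixed_torsion (ver Y) (hor X) Z p"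

lemmas hv_vfields = sections_vfields[OF hor_section] perp_vfields[OF ver_section]

lemma lie_derivative_add2:
  assumes "X \<in> vfields A" "Y \<in> vfields A" "Z \<in> vfields A" "Z' \<in> vfields A"
  shows "lie_derivative X g Y (Z + Z') p = lie_derivative X g Y Z p + lie_derivative X g Y Z' p"
  using lie_derivative_add[OF assms(1,3,4,2)] assms by (simp add: lie_derivative_sym[of X Y] vfields_add)

lemma lie_derivative_scale2:
  assumes "f \<in> C_inf A" "X \<in> vfields A" "Y \<in> vfields A" "Z \<in> vfields A"
  shows "lie_derivative X g Y (\<lambda>q. f q *\<^sub>R Z q) p = f p * lie_derivative X g Y Z p"
  using lie_derivative_scale[OF assms(1,2,4,3)] assms by (simp add: lie_derivative_sym[of X Y] vfields_scale)

lemma mixed_torsion_C_inf: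
  assumes "\<xi> \<in> sections A E_perp" "X \<in> sections A E" "Z \<in> vfields A"
  shows "mixed_torsion \<xi> X Z \<in> C_inf A"
  unfolding mixed_torsion_def[abs_def]
  using assms by (intro C_inf_intros lie_derivative_C_inf) (simp_all add: hv_vfields sections_vfields perp_vfields)

lemma mixed_torsion_add:
  assumes "\<xi> \<in> sections A E_perp" "X \<in> sections A E" "Z \<in> vfields A"
  shows "\<xi>' \<in> sections A E_perp \<Longrightarrow> mixed_torsion (\<xi> + \<xi>') X Z p = mixed_torsion \<xi> X Z p + mixed_torsion \<xi>' X Z p"
    "X' \<in> sections A E \<Longrightarrow> mixed_torsion \<xi> (X + X') Z p = mixed_torsion \<xi> X Z p + mixed_torsion \<xi> X' Z p"
    "Z' \<in> vfields A \<Longrightarrow> mixed_torsion \<xi> X (Z + Z') p = mixed_torsion \<xi> X Z p + mixed_torsion \<xi> X Z' p"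
  using assms
  by (simp_all add: mixed_torsion_def lie_derivative_add_direction lie_derivative_add lie_derivative_add2 hor_ver_add
      hv_vfields sections_vfields perp_vfields algebra_simps)

text \<open>Linearity over functions in \<open>\<xi>\<close> of the first term and in \<open>X\<close> of the second is where the
  orthogonality of \<open>\<xi>\<close> and \<open>ver Z\<close> to \<open>E\<close> enters.\<close>

lemma mixed_torsion_scale:
  assumes "f \<in> C_inf A" "\<xi> \<in> sections A E_perp" "X \<in> sections A E" "Z \<in> vfields A"
  shows "mixed_torsion (\<lambda>q. f q *\<^sub>R \<xi> q) X Z p = f p * mixed_torsion \<xi> X Z p"
    "mixed_torsion \<xi> (\<lambda>q. f q *\<^sub>R X q) Z p = f p * mixed_torsion \<xi> X Z p"
    "mixed_torsion \<xi> X (\<lambda>q. f q *\<^sub>R Z q) p = f p * mixed_torsion \<xi> X Z p"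
  using assms
  by (simp_all add: mixed_torsion_def lie_derivative_scale_direction lie_derivative_scale lie_derivative_scale2 hor_ver_scale
      hv_vfields sections_vfields perp_vfields hor_section ver_section perp_orthogonal algebra_simps)

lemma torsion_form_tensorial: "tensorial3 torsion_form"
  unfolding tensorial3_def
proof (intro ballI conjI allI)
  fix X Y Z assume V: "X \<in> vfields A" "Y \<in> vfields A" "Z \<in> vfields A"
  note hv = hor_section ver_section
  show "torsion_form X Y Z \<in> C_inf A"
    unfolding torsion_form_def[abs_def] using V by (intro C_inf_diff mixed_torsion_C_inf hv)
  fix p
  { fix W assume W: "W \<in> vfields A"
    show "torsion_form (X + W) Y Z p = torsion_form X Y Z p + torsion_form W Y Z p"
      "torsion_form X (Y + W) Z p = torsion_form X Y Z p + torsion_form X W Z p"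
      "torsion_form X Y (Z + W) p = torsion_form X Y Z p + torsion_form X Y W p"
      using V W by (simp_all add: torsion_form_def hor_ver_add mixed_torsion_add hv) }
  { fix f assume f: "f \<in> C_inf A"
    show "torsion_form (\<lambda>q. f q *\<^sub>R X q) Y Z p = f p * torsion_form X Y Z p"
      "torsion_form X (\<lambda>q. f q *\<^sub>R Y q) Z p = f p * torsion_form X Y Z p"
      "torsion_form X Y (\<lambda>q. f q *\<^sub>R Z q) p = f p * torsion_form X Y Z p"
      using V f by (simp_all add: torsion_form_def hor_ver_scale mixed_torsion_scale hv algebra_simps) }
qed

lemma mixed_torsion_0:
  assumes "Z \<in> vfields A"
  shows "X \<in> sections A E \<Longrightarrow> mixed_torsion 0 X Z p = 0"
    "\<xi> \<in> sections A E_perp \<Longrightarrow> mixed_torsion \<xi> 0 Z p = 0"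
  using mixed_torsion_add(1)[of 0 X Z 0 p] mixed_torsion_add(2)[of \<xi> 0 Z 0 p] zero_sections assms by simp_all

lemma mixed_torsion_on_sections:
  assumes "\<xi> \<in> sections A E_perp" "X \<in> sections A E"
  shows "Y \<in> sections A E \<Longrightarrow> mixed_torsion \<xi> X Y p = 1/2 * lie_derivative \<xi> g X Y p"
    "\<eta> \<in> sections A E_perp \<Longrightarrow> mixed_torsion \<xi> X \<eta> p = - (1/2) * lie_derivative X g \<xi> \<eta> p"
  using assms lie_derivative_add2[of X \<xi> 0 0 p] lie_derivative_add2[of \<xi> X 0 0 p]
  by (simp_all add: mixed_torsion_def hor_ver_of_section hor_ver_of_perp sections_vfields perp_vfields vfields_0)

lemma torsion_form_mixed:
  assumes "\<xi> \<in> sections A E_perp" "X \<in> sections A E" "Z \<in> vfields A"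
  shows "torsion_form \<xi> X Z p = mixed_torsion \<xi> X Z p"
  using assms by (simp add: torsion_form_def hor_ver_of_section hor_ver_of_perp mixed_torsion_0 zero_sections)

text \<open>Both directions come from splitting fields into horizontal and vertical parts;
  the torsion is additive in each argument because the connection is.\<close>

lemma torsion_conditions_iff:
  assumes D: "affine_connection A D"
  shows "((\<forall>X\<in>sections A E. \<forall>Y\<in>sections A E. torsion D X Y = 0) \<and>
    (\<forall>\<xi>\<in>sections A E_perp. \<forall>\<eta>\<in>sections A E_perp. torsion D \<xi> \<eta> = 0) \<and>
    (\<forall>X\<in>sections A E. \<forall>Y\<in>sections A E. \<forall>\<xi>\<in>sections A E_perp. \<forall>p.
       g p (torsion D \<xi> X p) (Y p) = 1/2 * lie_derivative \<xi> g X Y p) \<and>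
    (\<forall>X\<in>sections A E. \<forall>\<xi>\<in>sections A E_perp. \<forall>\<eta>\<in>sections A E_perp. \<forall>p.
       g p (torsion D \<xi> X p) (\<eta> p) = - (1/2) * lie_derivative X g \<xi> \<eta> p)) \<longleftrightarrow>
    (\<forall>X\<in>vfields A. \<forall>Y\<in>vfields A. \<forall>Z\<in>vfields A. \<forall>p. g p (torsion D X Y p) (Z p) = torsion_form X Y Z p)"
    (is "?L \<longleftrightarrow> ?R")
proof
  note secV = sections_vfields perp_vfields
  have DV: "D X Y \<in> vfields A" if "X \<in> vfields A" "Y \<in> vfields A" for X Y
  proof -
    have "D \<in> vfields A \<rightarrow>\<^sub>E (vfields A \<rightarrow>\<^sub>E vfields A)" using D by (simp add: affine_connection_def)
    from PiE_mem[OF PiE_mem[OF this that(1)] that(2)] show ?thesis .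
  qed
  have TV: "torsion D X Y \<in> vfields A" if "X \<in> vfields A" "Y \<in> vfields A" for X Y
    unfolding torsion_def using that by (intro vfields_diff DV lie_bracket_vfields)
  have skew: "torsion D X Y = - torsion D Y X" for X Y
    by (rule ext) (simp add: torsion_def lie_bracket_antisym[of X Y])
  {
    assume R: ?R
    have zero: "torsion D X Y = 0" if "X \<in> vfields A" "Y \<in> vfields A"
      "\<And>Z p. Z \<in> vfields A \<Longrightarrow> torsion_form X Y Z p = 0" for X Y
      using that R by (intro vfield_eqI) (simp_all add: TV vfields_0)
    show ?L
    proof (intro conjI ballI allI)
      fix X Y assume S: "X \<in> sections A E" "Y \<in> sections A E"
      show "torsion D X Y = 0"
        using S by (intro zero) (simp_all add: secV torsion_form_def hor_ver_of_section mixed_torsion_0)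
    next
      fix X Y assume S: "X \<in> sections A E_perp" "Y \<in> sections A E_perp"
      show "torsion D X Y = 0"
        using S by (intro zero) (simp_all add: secV torsion_form_def hor_ver_of_perp mixed_torsion_0)
    next
      fix X Y \<xi> p assume S: "X \<in> sections A E" "Y \<in> sections A E" "\<xi> \<in> sections A E_perp"
      show "g p (torsion D \<xi> X p) (Y p) = 1/2 * lie_derivative \<xi> g X Y p"
        using S R by (simp add: secV torsion_form_mixed mixed_torsion_on_sections)
    next
      fix X \<xi> \<eta> p assume S: "X \<in> sections A E" "\<xi> \<in> sections A E_perp" "\<eta> \<in> sections A E_perp"
      show "g p (torsion D \<xi> X p) (\<eta> p) = - (1/2) * lie_derivative X g \<xi> \<eta> p"
        using S R by (simp add: secV torsion_form_mixed mixed_torsion_on_sections)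
    qed
  }
  {
    assume L: ?L
    have add: "torsion D (X + Y) Z = torsion D X Z + torsion D Y Z"
      if "X \<in> vfields A" "Y \<in> vfields A" "Z \<in> vfields A" for X Y Z
      using D that unfolding affine_connection_def
      by (auto simp: torsion_def lie_bracket_add_left)
    have mixed: "g p (torsion D \<xi> X p) (Z p) = mixed_torsion \<xi> X Z p"
      if "\<xi> \<in> sections A E_perp" "X \<in> sections A E" "Z \<in> vfields A" for \<xi> X Z p
    proof -
      have "g p (torsion D \<xi> X p) (Z p) = g p (torsion D \<xi> X p) (hor Z p + ver Z p)"
        by (simp add: ver_def)
      also have "\<dots> = g p (torsion D \<xi> X p) (hor Z p) + g p (torsion D \<xi> X p) (ver Z p)"
        using that by (intro g_add_right) (simp_all add: TV hv_vfields secV)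
      finally show ?thesis
        using L that by (simp add: mixed_torsion_def hor_section ver_section)
    qed
    show ?R
    proof (intro ballI allI)
      fix X Y Z p assume V: "X \<in> vfields A" "Y \<in> vfields A" "Z \<in> vfields A"
      note hv = hv_vfields hor_section ver_section
      have split: "torsion D W Y = torsion D (hor W) Y + torsion D (ver W) Y" if "W \<in> vfields A" "Y \<in> vfields A" for W Y
        using add[of "hor W" "ver W" Y] that by (simp add: hor_plus_ver hv)
      \<comment> \<open>Condition (1) removes the purely horizontal and the purely vertical contributions.\<close>
      have h: "torsion D (hor X) Y = - torsion D (ver Y) (hor X)"
        using split[of Y "hor X"] L V by (subst skew) (simp add: hv)
      have v: "torsion D (ver X) Y = torsion D (ver X) (hor Y)"
        using split[of Y "ver X"] L V skew[of "ver X" Y] skew[of "ver X" "hor Y"] by (simp add: hv)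
      have "torsion D X Y = torsion D (ver X) (hor Y) - torsion D (ver Y) (hor X)"
        using split[OF V(1,2)] h v by simp
      then have "g p (torsion D X Y p) (Z p)
          = g p (torsion D (ver X) (hor Y) p) (Z p) - g p (torsion D (ver Y) (hor X) p) (Z p)"
        using V by (simp add: g_diff_left TV hv)
      then show "g p (torsion D X Y p) (Z p) = torsion_form X Y Z p"
        using V by (simp add: mixed hv torsion_form_def)
    qed
  }
qed

end

theorem theorem1p2:
  fixes A :: "('a::{t2_space, second_countable_topology}, 'e::euclidean_space) chart set"
    and g :: "'a tensor2"
    and E :: "'a \<Rightarrow> 'a tvec set"
    and r :: nat
  assumes "smooth_atlas A"
    and "riemannian_metric A g"
    and "distribution A r E"
  shows "\<exists>!D. affine_connection A D \<and> metric_compatible A g D \<and>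
    (\<forall>X\<in>sections A E. \<forall>Y\<in>sections A E. torsion D X Y = 0) \<and>
    (\<forall>\<xi>\<in>sections A (orth_complement A g E). \<forall>\<eta>\<in>sections A (orth_complement A g E).
       torsion D \<xi> \<eta> = 0) \<and>
    (\<forall>X\<in>sections A E. \<forall>Y\<in>sections A E. \<forall>\<xi>\<in>sections A (orth_complement A g E). \<forall>p.
       g p (torsion D \<xi> X p) (Y p) = 1/2 * lie_derivative \<xi> g X Y p) \<and>
    (\<forall>X\<in>sections A E. \<forall>\<xi>\<in>sections A (orth_complement A g E).
       \<forall>\<eta>\<in>sections A (orth_complement A g E). \<forall>p.
       g p (torsion D \<xi> X p) (\<eta> p) = - (1/2) * lie_derivative X g \<xi> \<eta> p)"
proof -
  interpret riemannian_distribution A g E r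
    using assms by unfold_locales
  have skew: "torsion_form Y X Z p = - torsion_form X Y Z p" for X Y Z p
    by (simp add: torsion_form_def)
  show ?thesis
    using metric_connection_with_torsion[OF torsion_form_tensorial skew]
    by (simp only: torsion_conditions_iff cong: conj_cong)
qed

end
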